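(* Let $F=(P,Q):\mathbb{R}^2\to\mathbb{R}^2$ be any Pinchuk map, and let $k$ be $\mathbb{R}$ or any subfield of $\mathbb{R}$ containing the coefficients of $F$. Although $F$ is generically two to one as a polynomial map of $\mathbb{R}^2$ to $\mathbb{R}^2$, the degree of the associated extension of function fields $k(P,Q)\subset k(x,y)$ is six. Furthermore, the extension has no automorphisms other than the identity (the only field automorphism of $k(x,y)$ fixing every element of $k(P,Q)$ is the identity), and so, in particular, it is not Galois.
   Context: Pinchuk maps. In $\mathbb{R}[x,y]$ put $t=xy-1$, $h=t(xt+1)$, $f=(xt+1)^2(t^2+y)$, $P=f+h$, and $q=-t^2-6th(h+1)$. A Pinchuk map is a polynomial map $F=(P,Q):\mathbb{R}^2\to\mathbb{R}^2$ with this $P$ and with $Q=q-u(f,h)$, where $u$ is a polynomial in two variables with real coefficients chosen so that the Jacobian determinant of $(P,Q)$ with respect to $(x,y)$ is $j(P,Q)=t^2+(t+f(13+15h))^2+f^2$. "Generically two to one" means that there is a nonempty Zariski open subset of the image plane $\mathbb{R}^2$, each point of which has exactly two inverse images in $\mathbb{R}^2$ under $F$. *)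

theory Defs
  imports "HOL-Algebra.Algebraic_Closure_Type" "HOL-Algebra.Generated_Fields"
begin

section \<open>Real polynomials in two variables\<close>

text \<open>
  The ring of real polynomials in \<open>x\<close> and \<open>y\<close> is rendered as \<^typ>\<open>real poly poly\<close>: the outer
  variable is \<open>y\<close> and the coefficients are polynomials in \<open>x\<close>, so
  \<open>Polynomial.coeff (Polynomial.coeff p j) i\<close> is the coefficient of \<open>x ^ i * y ^ j\<close> in \<open>p\<close>.
\<close>

definition const2 :: "real \<Rightarrow> real poly poly" where
  "const2 c = [:[:c:]:]"

definition var_x :: "real poly poly" where
  "var_x = [:[:0, 1:]:]"

definition var_y :: "real poly poly" where
  "var_y = [:0, 1:]"

definition eval2 :: "real poly poly \<Rightarrow> real \<times> real \<Rightarrow> real" where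
  "eval2 p = (\<lambda>(a, b). poly (map_poly (\<lambda>c. poly c a) p) b)"

text \<open>The polynomial \<open>u(f, h)\<close>: \<open>f\<close> replaces the inner variable of \<open>u\<close> and \<open>h\<close> the outer one.\<close>

definition subst2 :: "real poly poly \<Rightarrow> real poly poly \<Rightarrow> real poly poly \<Rightarrow> real poly poly" where
  "subst2 u f h = poly (map_poly (\<lambda>c. poly (map_poly const2 c) f) u) h"

definition partial_x :: "real poly poly \<Rightarrow> real poly poly" where
  "partial_x p = map_poly pderiv p"

definition partial_y :: "real poly poly \<Rightarrow> real poly poly" where
  "partial_y p = pderiv p"

definition jacobian_det :: "real poly poly \<Rightarrow> real poly poly \<Rightarrow> real poly poly" where
  "jacobian_det p q = partial_x p * partial_y q - partial_y p * partial_x q"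

definition polynomial_map ::
    "real poly poly \<Rightarrow> real poly poly \<Rightarrow> real \<times> real \<Rightarrow> real \<times> real" where
  "polynomial_map p q z = (eval2 p z, eval2 q z)"


section \<open>Pinchuk maps\<close>

definition pinchuk_t :: "real poly poly" where
  "pinchuk_t = var_x * var_y - 1"

definition pinchuk_h :: "real poly poly" where
  "pinchuk_h = pinchuk_t * (var_x * pinchuk_t + 1)"

definition pinchuk_f :: "real poly poly" where
  "pinchuk_f = (var_x * pinchuk_t + 1)^2 * (pinchuk_t^2 + var_y)"

definition pinchuk_q :: "real poly poly" where
  "pinchuk_q = - (pinchuk_t^2) - 6 * pinchuk_t * pinchuk_h * (pinchuk_h + 1)"

text \<open>
  The polynomial \<open>u\<close> is not unique (any polynomial in \<open>f + h\<close> can be added to it), whence a predicate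
  on the pair of components rather than a single pair.
\<close>

definition is_pinchuk_map :: "real poly poly \<Rightarrow> real poly poly \<Rightarrow> bool" where
  "is_pinchuk_map P Q \<longleftrightarrow>
     P = pinchuk_f + pinchuk_h \<and>
     (\<exists>u. Q = pinchuk_q - subst2 u pinchuk_f pinchuk_h) \<and>
     jacobian_det P Q =
       pinchuk_t^2 + (pinchuk_t + pinchuk_f * (13 + 15 * pinchuk_h))^2 + pinchuk_f^2"


section \<open>Generically two to one\<close>

definition zariski_open :: "(real \<times> real) set \<Rightarrow> bool" where
  "zariski_open U \<longleftrightarrow> (\<exists>S. U = - {z. \<forall>p\<in>S. eval2 p z = 0})"

text \<open>Since \<^const>\<open>card\<close> is 0 on infinite sets, the fibres in question have exactly two elements.\<close>

definition generically_two_to_one :: "(real \<times> real \<Rightarrow> real \<times> real) \<Rightarrow> bool" where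
  "generically_two_to_one F \<longleftrightarrow>
     (\<exists>U. zariski_open U \<and> U \<noteq> {} \<and> (\<forall>w\<in>U. card (F -` {w}) = 2))"


section \<open>Function fields\<close>

text \<open>The field of real rational functions in \<open>x\<close> and \<open>y\<close>, as a structure of HOL-Algebra.\<close>

abbreviation real_rat_functions :: "real poly poly fract ring" where
  "real_rat_functions \<equiv> ring_of_type_algebra"

text \<open>
  \<open>k(S)\<close> for a subfield \<open>k\<close> of the reals and a set \<open>S\<close> of polynomials, inside the field of real
  rational functions. As \<open>x\<close> and \<open>y\<close> are algebraically independent over the reals, taking
  \<open>S = {x, y}\<close> gives the rational function field \<open>k(x,y)\<close>.
\<close>

definition adjoin :: "real set \<Rightarrow> real poly poly set \<Rightarrow> real poly poly fract set" where
  "adjoin k S = generate_field real_rat_functions (to_fract ` (const2 ` k \<union> S))"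


section \<open>Automorphisms of a field extension\<close>

text \<open>
  Here \<open>K \<subseteq> E\<close> are subfields of \<open>R\<close>. Automorphisms are taken to be extensional, so that each of
  them is represented by exactly one function; the identity is \<open>\<lambda>z\<in>E. z\<close>.
\<close>

definition relative_automorphisms ::
    "('a, 'b) ring_scheme \<Rightarrow> 'a set \<Rightarrow> 'a set \<Rightarrow> ('a \<Rightarrow> 'a) set" where
  "relative_automorphisms R K E =
     {\<sigma> \<in> extensional E.
        \<sigma> \<in> ring_iso (R\<lparr>carrier := E\<rparr>) (R\<lparr>carrier := E\<rparr>) \<and> (\<forall>z\<in>K. \<sigma> z = z)}"

definition galois_extension :: "('a, 'b) ring_scheme \<Rightarrow> 'a set \<Rightarrow> 'a set \<Rightarrow> bool" where
  "galois_extension R K E \<longleftrightarrow>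
     (\<forall>z\<in>E. \<not> ring.transcendental R K z) \<and>
     {z \<in> E. \<forall>\<sigma>\<in>relative_automorphisms R K E. \<sigma> z = z} = K"

end

theory Submission
  imports Defs
begin

text \<open>
  Solving \<open>t f = h f - h\<^sup>2 (h + 1)\<close> for \<open>t\<close> and then \<open>h = t (x t + 1)\<close> for \<open>x\<close> shows
  \<open>\<real>(x, y) = \<real>(P, f)\<close>. The Jacobian condition determines \<open>u\<close> up to a polynomial in \<open>P\<close>, and for
  one explicit choice \<open>Q f\<^sup>2\<close> is a polynomial of degree six in \<open>f\<close> over \<open>\<rat>[P]\<close>, so that on a level
  set of \<open>P\<close> the function \<open>Q\<close> is a rational function \<open>r\<close> of \<open>f\<close> with a pole of order two at \<open>0\<close> and
  a pole of order four at infinity.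

  Two to one: \<open>j(P, f) = f\<close>, so \<open>r\<close> has derivative \<open>j(P, Q) / f\<close>. It is strictly monotone on each
  side of \<open>0\<close>, where it runs from \<open>- \<infinity>\<close> to \<open>\<infinity>\<close>.

  Degree six: a numerator of degree six, coprime to the denominator \<open>f\<^sup>2\<close>, makes \<open>1, f, \<dots>, f\<^sup>5\<close>
  linearly independent over \<open>\<real>(P, Q)\<close>.

  Automorphisms: an automorphism fixes \<open>P\<close> and maps \<open>f\<close> to some \<open>A / B\<close> with \<open>r (A / B) = r f\<close>.
  Comparing the two poles gives \<open>A / B = \<plusminus> f\<close>, and the sign is positive since \<open>r\<close> has a term of
  odd order.
\<close>

section \<open>Polynomials in two variables\<close>

text \<open>Putting a constant polynomial for the outer variable first makes evaluation a
  composition of two \<open>poly\<close>s, so the homomorphism rules come from those of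
  \<open>poly\<close>.\<close>

lemma eval2_conv_poly: "eval2 p z = poly (poly p [:snd z:]) (fst z)"
proof -
  have "poly (map_poly (\<lambda>c. poly c a) p) b = poly (poly p [:b:]) a" for a b
    by (induction p) (auto simp: map_poly_pCons)
  then show ?thesis
    by (simp add: eval2_def case_prod_unfold)
qed

lemma eval2_simps [simp]:
  "eval2 0 z = 0" "eval2 1 z = 1" "eval2 (numeral n) z = numeral n"
  "eval2 (p + q) z = eval2 p z + eval2 q z" "eval2 (p - q) z = eval2 p z - eval2 q z"
  "eval2 (- p) z = - eval2 p z" "eval2 (p * q) z = eval2 p z * eval2 q z"
  "eval2 (p ^ m) z = eval2 p z ^ m"
  "eval2 (const2 c) z = c" "eval2 var_x z = fst z" "eval2 var_y z = snd z"
  by (simp_all add: eval2_conv_poly const2_def var_x_def var_y_def)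

lemma eval2_pCons [simp]: "eval2 (pCons c p) z = poly c (fst z) + snd z * eval2 p z"
  by (simp add: eval2_conv_poly)

lemma eval2_smult [simp]: "eval2 (smult c p) z = poly c (fst z) * eval2 p z"
  by (simp add: eval2_conv_poly)

lemma eval2_sum: "eval2 (sum g A) z = (\<Sum>i\<in>A. eval2 (g i) z)"
  by (induction A rule: infinite_finite_induct) auto

lemma eval2_prod: "eval2 (prod g A) z = (\<Prod>i\<in>A. eval2 (g i) z)"
  by (induction A rule: infinite_finite_induct) auto

lemma eval2_conv_slice: "eval2 p (a, b) = poly (map_poly (\<lambda>c. poly c a) p) b"
  by (simp add: eval2_def)

lemma poly_eq_0_cofinite:
  fixes p :: "real poly"
  assumes "finite {x. poly p x \<noteq> 0}"
  shows "p = 0"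
proof (rule ccontr)
  assume "p \<noteq> 0"
  then have "finite {x. poly p x = 0}"
    by (rule poly_roots_finite)
  with assms have "finite ({x. poly p x \<noteq> 0} \<union> {x. poly p x = 0})"
    by blast
  moreover have "{x. poly p x \<noteq> 0} \<union> {x. poly p x = 0} = UNIV"
    by blast
  ultimately show False
    using infinite_UNIV_char_0 by metis
qed

text \<open>Outside \<open>S\<close> every slice vanishes cofinitely, hence identically; so each
  coefficient vanishes cofinitely and is zero. The finite exceptions absorb points that a map such
  as \<open>(f, h)\<close> or \<open>(P, f)\<close> misses.\<close>

lemma eval2_eq_0_cofinite:
  assumes "finite S" and "\<And>a. a \<notin> S \<Longrightarrow> finite {b. eval2 p (a, b) \<noteq> 0}"
  shows "p = 0"
proof -
  have "poly (coeff p i) a = 0" if "a \<notin> S" for i a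
  proof -
    have "map_poly (\<lambda>c. poly c a) p = 0"
      using assms(2)[OF that] by (intro poly_eq_0_cofinite) (simp add: eval2_conv_slice)
    then have "coeff (map_poly (\<lambda>c. poly c a) p) i = 0"
      by simp
    then show ?thesis
      by (simp add: coeff_map_poly)
  qed
  then have "coeff p i = 0" for i
    by (intro poly_eq_0_cofinite finite_subset[OF _ \<open>finite S\<close>]) auto
  then show ?thesis
    by (simp add: poly_eq_iff)
qed

text \<open>Turns polynomial identities into identities between real numbers, which
  \<open>simp\<close> and \<open>Groebner_Basis.algebra\<close> can settle.\<close>

lemma eval2_eqI:
  assumes "\<And>z. eval2 p z = eval2 q z"
  shows "p = q"
  using eval2_eq_0_cofinite[of "{}" "p - q"] assms by simp

section \<open>Substitution of polynomials\<close>

definition subst1 :: "real poly \<Rightarrow> real poly poly \<Rightarrow> real poly poly" where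
  "subst1 c f = poly (map_poly const2 c) f"

lemma const2_0 [simp]: "const2 0 = 0"
  by (simp add: const2_def)

lemma subst1_0 [simp]: "subst1 0 f = 0"
  by (simp add: subst1_def)

lemma subst1_pCons: "subst1 (pCons a c) f = const2 a + f * subst1 c f"
  by (simp add: subst1_def map_poly_pCons)

lemma eval2_subst1 [simp]: "eval2 (subst1 c f) z = poly c (eval2 f z)"
  by (induction c) (auto simp: subst1_pCons)

lemma subst2_0 [simp]: "subst2 0 f h = 0"
  by (simp add: subst2_def)

lemma subst2_pCons: "subst2 (pCons c u) f h = subst1 c f + h * subst2 u f h"
  by (simp add: subst2_def map_poly_pCons subst1_def)

lemma eval2_subst2 [simp]: "eval2 (subst2 u f h) z = eval2 u (eval2 f z, eval2 h z)"
  by (induction u) (auto simp: subst2_pCons)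

lemma subst2_simps:
  "subst2 1 f h = 1" "subst2 (numeral n) f h = numeral n" "subst2 (u + v) f h = subst2 u f h + subst2 v f h"
  "subst2 (u - v) f h = subst2 u f h - subst2 v f h" "subst2 (- u) f h = - subst2 u f h"
  "subst2 (u * v) f h = subst2 u f h * subst2 v f h" "subst2 (u ^ m) f h = subst2 u f h ^ m"
  "subst2 (const2 c) f h = const2 c" "subst2 var_x f h = f" "subst2 var_y f h = h"
  by (rule eval2_eqI; simp)+

lemma subst2_smult: "subst2 (smult c u) f h = subst1 c f * subst2 u f h"
  by (rule eval2_eqI) simp

lemma subst2_sum: "subst2 (sum g A) f h = (\<Sum>i\<in>A. subst2 (g i) f h)"
  by (rule eval2_eqI) (simp add: eval2_sum)

lemma subst2_prod: "subst2 (prod g A) f h = (\<Prod>i\<in>A. subst2 (g i) f h)"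
  by (rule eval2_eqI) (simp add: eval2_prod)


section \<open>Partial derivatives and the derivation \<open>jacobian_det p\<close>\<close>

lemma partial_x_pCons: "partial_x (pCons c p) = pCons (pderiv c) (partial_x p)"
  by (simp add: partial_x_def map_poly_pCons)

lemma partial_x_simps:
  "partial_x 0 = 0" "partial_x 1 = 0" "partial_x (numeral n) = 0"
  "partial_x (p + q) = partial_x p + partial_x q" "partial_x (p - q) = partial_x p - partial_x q"
  "partial_x (- p) = - partial_x p" "partial_x (const2 c) = 0"
  "partial_x var_x = 1" "partial_x var_y = 0"
proof -
  show "partial_x 1 = 0" "partial_x (numeral n) = 0"
    by (simp_all add: one_pCons numeral_poly partial_x_def map_poly_pCons pderiv_pCons)
qed (auto simp: partial_x_def poly_eq_iff coeff_map_poly pderiv_add pderiv_diff pderiv_minus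
      const2_def var_x_def var_y_def map_poly_pCons one_pCons pderiv_pCons)

lemma partial_x_mult: "partial_x (p * q) = p * partial_x q + q * partial_x p"
proof (induction p)
  case (pCons c p)
  have 1: "partial_x (smult c q) = smult c (partial_x q) + smult (pderiv c) q"
    by (auto simp: partial_x_def poly_eq_iff coeff_map_poly pderiv_mult mult.commute)
  have 2: "partial_x (pCons 0 p) = pCons 0 (partial_x p)" for p
    by (simp add: partial_x_pCons)
  show ?case
    by (simp add: partial_x_simps(4) 1 2 partial_x_pCons pCons.IH)
qed (simp add: partial_x_simps)

lemma partial_y_simps:
  "partial_y 0 = 0" "partial_y 1 = 0" "partial_y (numeral n) = 0"
  "partial_y (p + q) = partial_y p + partial_y q" "partial_y (p - q) = partial_y p - partial_y q"
  "partial_y (- p) = - partial_y p" "partial_y (const2 c) = 0"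
  "partial_y var_x = 0" "partial_y var_y = 1"
  by (simp_all add: partial_y_def pderiv_add pderiv_diff pderiv_minus const2_def var_x_def
      var_y_def pderiv_pCons)

lemma partial_y_mult: "partial_y (p * q) = p * partial_y q + q * partial_y p"
  by (simp add: partial_y_def pderiv_mult)

lemma jacobian_det_simps:
  "jacobian_det p 0 = 0" "jacobian_det p 1 = 0" "jacobian_det p (numeral n) = 0"
  "jacobian_det p (const2 c) = 0"
  "jacobian_det p (q + r) = jacobian_det p q + jacobian_det p r"
  "jacobian_det p (q - r) = jacobian_det p q - jacobian_det p r"
  "jacobian_det p (- q) = - jacobian_det p q"
  "jacobian_det p (q * r) = q * jacobian_det p r + r * jacobian_det p q"
  by (simp_all add: jacobian_det_def partial_x_simps partial_y_simps partial_x_mult partial_y_mult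
      algebra_simps)

lemma jacobian_det_subst1: "jacobian_det p (subst1 c f) = subst1 (pderiv c) f * jacobian_det p f"
proof (induction c)
  case (pCons a c)
  have "subst1 (pderiv (pCons a c)) f = subst1 c f + f * subst1 (pderiv c) f"
    by (rule eval2_eqI) (simp add: pderiv_pCons)
  with pCons.IH show ?case
    by (simp add: subst1_pCons jacobian_det_simps algebra_simps)
qed (simp add: jacobian_det_simps)

text \<open>The chain rule for the derivation \<open>jacobian_det p\<close>, by induction on
  \<open>u\<close> in Horner form.\<close>

lemma jacobian_det_subst2:
  "jacobian_det p (subst2 u f h) =
     subst2 (partial_x u) f h * jacobian_det p f + subst2 (partial_y u) f h * jacobian_det p h"
proof (induction u)
  case (pCons c u)
  have "subst2 (partial_y (pCons c u)) f h = subst2 u f h + h * subst2 (partial_y u) f h"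
    by (rule eval2_eqI) (simp add: partial_y_def pderiv_pCons)
  with pCons.IH show ?case
    by (simp add: subst2_pCons partial_x_pCons jacobian_det_simps jacobian_det_subst1 algebra_simps)
qed (simp add: jacobian_det_simps partial_x_simps partial_y_simps)


section \<open>Polynomials constant along antidiagonals\<close>

lemma DERIV_eval2_antidiagonal:
  "((\<lambda>s. eval2 w (a + s, b - s)) has_real_derivative
     eval2 (partial_x w - partial_y w) (a + s, b - s)) (at s)"
proof (induction w)
  case (pCons c w)
  show ?case
    by (rule derivative_eq_intros pCons.IH DERIV_chain2[OF poly_DERIV] refl | simp)+
      (simp add: partial_x_pCons partial_y_def pderiv_pCons algebra_simps)
qed (simp add: partial_x_simps partial_y_simps)

text \<open>The derivative in direction \<open>(1, -1)\<close> vanishes, so the value at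
  \<open>(a, b)\<close> equals that at \<open>(a + b, 0)\<close>, where only the coefficient of
  \<open>y^0\<close> survives.\<close>

lemma eval2_antidiagonal_constant:
  assumes "partial_x w = partial_y w"
  shows "eval2 w (a, b) = poly (coeff w 0) (a + b)"
proof -
  have "\<forall>s. ((\<lambda>s. eval2 w (a + s, b - s)) has_real_derivative 0) (at s)"
    using DERIV_eval2_antidiagonal[of w a b] assms by simp
  from DERIV_isconst_all[OF this, of 0 b] have "eval2 w (a, b) = eval2 w (a + b, 0)"
    by simp
  also have "\<dots> = poly (coeff w 0) (a + b)"
    by (cases w) simp
  finally show ?thesis .
qed


section \<open>Pinchuk maps in normal form\<close>

definition pinchuk_P :: "real poly poly" where
  "pinchuk_P = pinchuk_f + pinchuk_h"

text \<open>The Jacobian condition determines \<open>u\<close> up to a polynomial in \<open>f + h\<close>; this is the solution with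
  \<open>u(f, 0) = 0\<close>.\<close>

definition pinchuk_u :: "real poly poly" where
  "pinchuk_u = 170 * var_x * var_y + 91 * var_y^2 + 195 * var_x * var_y^2 + 69 * var_y^3
     + 75 * var_x * var_y^3 + const2 (75/4) * var_y^4"

definition pinchuk_Q :: "real poly poly" where
  "pinchuk_Q = pinchuk_q - subst2 pinchuk_u pinchuk_f pinchuk_h"

text \<open>Because \<open>h - t = x * t^2\<close> and \<open>x * (t^2 + y) = h + 1\<close>, the
  product \<open>(h - t) * f\<close> is \<open>h^2 * (h + 1)\<close>. Where \<open>f\<close> is
  nonzero, this recovers \<open>t\<close> from \<open>f\<close> and \<open>h\<close>.\<close>

lemma pinchuk_t_mult_f:
  "pinchuk_t * pinchuk_f = pinchuk_h * pinchuk_f - pinchuk_h^2 * (pinchuk_h + 1)"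
proof (rule eval2_eqI)
  fix z :: "real \<times> real"
  obtain x y where z: "z = (x, y)" by force
  show "eval2 (pinchuk_t * pinchuk_f) z =
          eval2 (pinchuk_h * pinchuk_f - pinchuk_h^2 * (pinchuk_h + 1)) z"
    unfolding pinchuk_t_def pinchuk_h_def pinchuk_f_def z by simp Groebner_Basis.algebra
qed

lemma eval2_pinchuk_t_mult_f:
  "eval2 pinchuk_t z * eval2 pinchuk_f z =
     eval2 pinchuk_h z * eval2 pinchuk_f z - (eval2 pinchuk_h z)^2 * (eval2 pinchuk_h z + 1)"
  using arg_cong[OF pinchuk_t_mult_f, of "\<lambda>p. eval2 p z"] by simp

lemma partial_pinchuk_t: "partial_x pinchuk_t = var_y" "partial_y pinchuk_t = var_x"
  by (simp_all add: pinchuk_t_def partial_x_simps partial_x_mult partial_y_simps partial_y_mult)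

lemma partial_pinchuk_h:
  "partial_x pinchuk_h = var_y * (2 * var_x * pinchuk_t + 1) + pinchuk_t^2"
  "partial_y pinchuk_h = var_x * (2 * var_x * pinchuk_t + 1)"
  by (simp_all add: pinchuk_h_def partial_x_simps partial_x_mult partial_y_simps partial_y_mult
      partial_pinchuk_t algebra_simps power2_eq_square)

lemma partial_pinchuk_f:
  "partial_x pinchuk_f = 2 * (var_x * pinchuk_t + 1) * (var_x * var_y + pinchuk_t) * (pinchuk_t^2 + var_y)
     + (var_x * pinchuk_t + 1)^2 * (2 * pinchuk_t * var_y)"
  "partial_y pinchuk_f = 2 * (var_x * pinchuk_t + 1) * var_x^2 * (pinchuk_t^2 + var_y)
     + (var_x * pinchuk_t + 1)^2 * (2 * pinchuk_t * var_x + 1)"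
  by (simp_all add: pinchuk_f_def power2_eq_square partial_x_simps partial_x_mult partial_y_simps
      partial_y_mult partial_pinchuk_t algebra_simps)

text \<open>As \<open>P = f + h\<close>, this amounts to \<open>j(f, h) = - f\<close>. Together with
  \<open>jacobian_det_P_f\<close> it makes \<open>j(P, w(f, h))\<close> equal to \<open>f\<close>
  times \<open>w_x - w_y\<close> taken at \<open>(f, h)\<close>.\<close>

lemma jacobian_det_P_h: "jacobian_det pinchuk_P pinchuk_h = - pinchuk_f"
proof (rule eval2_eqI)
  fix z :: "real \<times> real"
  obtain x y where z: "z = (x, y)" by force
  show "eval2 (jacobian_det pinchuk_P pinchuk_h) z = eval2 (- pinchuk_f) z"
    unfolding jacobian_det_def pinchuk_P_def partial_x_simps partial_y_simps partial_pinchuk_h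
      partial_pinchuk_f
    unfolding pinchuk_f_def pinchuk_t_def z by simp Groebner_Basis.algebra
qed

lemma jacobian_det_P_f: "jacobian_det pinchuk_P pinchuk_f = pinchuk_f"
proof -
  have "jacobian_det pinchuk_P pinchuk_P = 0"
    by (simp add: jacobian_det_def)
  then have "jacobian_det pinchuk_P pinchuk_f + jacobian_det pinchuk_P pinchuk_h = 0"
    using jacobian_det_simps(5)[of pinchuk_P pinchuk_f pinchuk_h] by (simp add: pinchuk_P_def)
  then show ?thesis
    by (simp add: jacobian_det_P_h)
qed

text \<open>The right-hand side is what results from applying the derivation to
  \<open>pinchuk_t_mult_f\<close> and cancelling \<open>f\<close>.\<close>

lemma jacobian_det_P_t:
  "jacobian_det pinchuk_P pinchuk_t = 3 * pinchuk_h^2 + 3 * pinchuk_h - pinchuk_f - pinchuk_t"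
proof (rule eval2_eqI)
  fix z :: "real \<times> real"
  obtain x y where z: "z = (x, y)" by force
  show "eval2 (jacobian_det pinchuk_P pinchuk_t) z =
          eval2 (3 * pinchuk_h^2 + 3 * pinchuk_h - pinchuk_f - pinchuk_t) z"
    unfolding jacobian_det_def pinchuk_P_def partial_x_simps partial_y_simps partial_pinchuk_h
      partial_pinchuk_f partial_pinchuk_t
    unfolding pinchuk_f_def pinchuk_h_def pinchuk_t_def z by simp Groebner_Basis.algebra
qed

lemma jacobian_det_P_Q:
  "jacobian_det pinchuk_P pinchuk_Q =
     pinchuk_t^2 + (pinchuk_t + pinchuk_f * (13 + 15 * pinchuk_h))^2 + pinchuk_f^2"
proof -
  let ?f = pinchuk_f and ?h = pinchuk_h and ?t = pinchuk_t
  have "jacobian_det pinchuk_P pinchuk_Q =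
      (- 2 * ?t - 6 * ?h * (?h + 1)) * (3 * ?h^2 + 3 * ?h - ?f - ?t) + 6 * ?t * (2 * ?h + 1) * ?f
      - ?f * (170 * ?h + 195 * ?h^2 + 75 * ?h^3 - (170 * ?f + 182 * ?h + 390 * ?f * ?h + 207 * ?h^2
      + 225 * ?f * ?h^2 + 75 * ?h^3))"
    unfolding pinchuk_Q_def pinchuk_q_def pinchuk_u_def power2_eq_square power3_eq_cube
      power4_eq_xxxx
    by (simp add: jacobian_det_simps jacobian_det_P_h jacobian_det_P_t jacobian_det_P_f subst2_simps,
        rule eval2_eqI, simp, Groebner_Basis.algebra)
  \<comment> \<open>As polynomials in \<open>t\<close>, \<open>f\<close>, \<open>h\<close> the two
    sides differ; they agree modulo the relation \<open>pinchuk_t_mult_f\<close>.\<close>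
  then show ?thesis
    using pinchuk_t_mult_f by Groebner_Basis.algebra
qed

text \<open>Inverts \<open>(x, y) \<mapsto> (f, h)\<close>: solving
  \<open>h = t * (x * t + 1)\<close> gives \<open>x\<close>, and
  \<open>f = (h / t)^2 * (t^2 + y)\<close> gives \<open>y\<close>. The assumed relation ensures that
  \<open>x * y - 1\<close> is again \<open>t\<close>.\<close>

lemma pinchuk_point:
  fixes b h t :: real
  assumes "b \<noteq> 0" "h \<noteq> 0" "t \<noteq> 0" and t: "t * b = h * b - h^2 * (h + 1)"
  obtains z where "eval2 pinchuk_t z = t" "eval2 pinchuk_f z = b" "eval2 pinchuk_h z = h"
proof -
  define x where "x = (h - t) / t^2"
  define y where "y = t^2 * (b - h^2) / h^2"
  have "x * y = (h * b - t * b - h^2 * (h - t)) / h^2"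
    using assms(2,3) by (simp add: x_def y_def field_simps)
  also have "\<dots> = (h^2 * (h + 1) - h^2 * (h - t)) / h^2"
    using t by simp
  also have "\<dots> = t + 1"
    using assms(2) by (simp add: field_simps)
  finally have 1: "x * y - 1 = t"
    by simp
  have 2: "x * t + 1 = h / t"
    using assms(3) by (simp add: x_def field_simps power2_eq_square)
  have 3: "t^2 + y = t^2 * b / h^2"
    using assms(2) by (simp add: y_def field_simps)
  have et: "eval2 pinchuk_t (x, y) = t"
    using 1 by (simp add: pinchuk_t_def)
  have "eval2 pinchuk_h (x, y) = h"
    using assms(3) by (simp add: pinchuk_h_def et 2)
  moreover have "eval2 pinchuk_f (x, y) = b"
    using assms(2,3) by (simp add: pinchuk_f_def et 2 3 power_divide)
  ultimately show thesis
    using et that by blast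
qed

text \<open>Dividing the relation by \<open>f\<close> determines \<open>t\<close>; then
  \<open>h\<close> determines \<open>x\<close> because \<open>t\<close> is nonzero, and
  \<open>f\<close> determines \<open>y\<close> because \<open>x * t + 1\<close> is nonzero.\<close>

lemma pinchuk_point_unique:
  assumes "eval2 pinchuk_f z = eval2 pinchuk_f z'" "eval2 pinchuk_h z = eval2 pinchuk_h z'"
    and "eval2 pinchuk_f z \<noteq> 0" "eval2 pinchuk_t z \<noteq> 0"
  shows "z = z'"
proof -
  obtain x y x' y' where z: "z = (x, y)" "z' = (x', y')"
    by force
  have t: "eval2 pinchuk_t z' = eval2 pinchuk_t z"
    using eval2_pinchuk_t_mult_f[of z] eval2_pinchuk_t_mult_f[of z'] assms(1-3)
    by (metis mult_right_cancel)
  let ?t = "eval2 pinchuk_t z"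
  have h: "?t * (x * ?t + 1) = ?t * (x' * ?t + 1)"
    using assms(2) by (simp add: pinchuk_h_def z t[unfolded z])
  with assms(4) have x: "x = x'"
    by simp
  have f: "(x * ?t + 1)^2 * (?t^2 + y) = (x * ?t + 1)^2 * (?t^2 + y')"
    using assms(1) by (simp add: pinchuk_f_def z t[unfolded z] x)
  moreover have "x * ?t + 1 \<noteq> 0"
    using assms(3) by (auto simp: pinchuk_f_def z)
  ultimately show ?thesis
    using x z by simp
qed

text \<open>Algebraic independence of \<open>f\<close> and \<open>h\<close>: for
  \<open>f = a\<close> nonzero, all but finitely many values \<open>b\<close> of \<open>h\<close>
  are attained.\<close>

lemma subst2_f_h_eq_0:
  assumes "subst2 w pinchuk_f pinchuk_h = 0"
  shows "w = 0"
proof (rule eval2_eq_0_cofinite)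
  show "finite {0::real}" by simp
  fix a :: real assume a: "a \<notin> {0}"
  \<comment> \<open>The cubic is \<open>t * a\<close> as the relation prescribes it, so off its
    roots both \<open>t\<close> and \<open>b\<close> are nonzero and \<open>pinchuk_point\<close>
    applies.\<close>
  have "{b. eval2 w (a, b) \<noteq> 0} \<subseteq> {b. poly [:0, a, -1, -1:] b = 0}"
  proof safe
    fix b assume "eval2 w (a, b) \<noteq> 0"
    show "poly [:0, a, -1, -1:] b = 0"
    proof (rule ccontr)
      assume *: "poly [:0, a, -1, -1:] b \<noteq> 0"
      define t where "t = b - b^2 * (b + 1) / a"
      have t: "t * a = b * a - b^2 * (b + 1)"
        using a by (simp add: t_def field_simps)
      have "poly [:0, a, -1, -1:] b = b * a - b^2 * (b + 1)"
        by (simp add: algebra_simps power2_eq_square)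
      with * t have "t * a \<noteq> 0"
        by metis
      with * have "b \<noteq> 0" "t \<noteq> 0"
        by auto
      moreover have "a \<noteq> 0"
        using a by simp
      ultimately obtain z where "eval2 pinchuk_f z = a" "eval2 pinchuk_h z = b"
        using pinchuk_point[OF _ _ _ t] by blast
      then have "eval2 w (a, b) = eval2 (subst2 w pinchuk_f pinchuk_h) z"
        by simp
      with assms \<open>eval2 w (a, b) \<noteq> 0\<close> show False
        by simp
    qed
  qed
  then show "finite {b. eval2 w (a, b) \<noteq> 0}"
    by (rule finite_subset) (rule poly_roots_finite, simp)
qed

text \<open>The difference \<open>w\<close> of two admissible \<open>u\<close> has
  \<open>w_x = w_y\<close>, hence \<open>w(f, h)\<close> is a polynomial in
  \<open>f + h = P\<close>. All Pinchuk maps thus differ by shears of the image plane only.\<close>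

lemma pinchuk_map_normal_form:
  assumes "is_pinchuk_map P Q"
  obtains v where "P = pinchuk_P" "Q = pinchuk_Q - subst1 v pinchuk_P"
proof -
  from assms obtain u where P: "P = pinchuk_P"
    and Q: "Q = pinchuk_q - subst2 u pinchuk_f pinchuk_h"
    and j: "jacobian_det P Q =
       pinchuk_t^2 + (pinchuk_t + pinchuk_f * (13 + 15 * pinchuk_h))^2 + pinchuk_f^2"
    by (auto simp: is_pinchuk_map_def pinchuk_P_def)
  define w where "w = u - pinchuk_u"
  have Q': "Q = pinchuk_Q - subst2 w pinchuk_f pinchuk_h"
    by (simp add: Q w_def pinchuk_Q_def subst2_simps)
  have "jacobian_det pinchuk_P (subst2 w pinchuk_f pinchuk_h) = 0"
    using j by (simp add: P Q' jacobian_det_simps jacobian_det_P_Q)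
  then have "pinchuk_f * subst2 (partial_x w - partial_y w) pinchuk_f pinchuk_h = 0"
    by (simp add: jacobian_det_subst2 jacobian_det_P_f jacobian_det_P_h subst2_simps algebra_simps)
  moreover have "pinchuk_f \<noteq> 0"
  proof
    assume "pinchuk_f = 0"
    then have "eval2 pinchuk_f (0, 0) = 0" by simp
    then show False by (simp add: pinchuk_f_def pinchuk_t_def)
  qed
  ultimately have "partial_x w = partial_y w"
    using subst2_f_h_eq_0[of "partial_x w - partial_y w"] by simp
  then have "eval2 w (a, b) = poly (coeff w 0) (a + b)" for a b
    by (rule eval2_antidiagonal_constant)
  then have "subst2 w pinchuk_f pinchuk_h = subst1 (coeff w 0) pinchuk_P"
    by (intro eval2_eqI) (simp add: pinchuk_P_def)
  with P Q' show thesis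
    using that by simp
qed


section \<open>The fibres of a Pinchuk map\<close>

text \<open>The inner variable stands for \<open>P\<close>, the outer one for \<open>f\<close>.\<close>

definition pinchuk_sextic :: "real poly poly" where
  "pinchuk_sextic =
     [:[:0, 0, 0, 0, -1, -2, -1:], [:0, 0, 0, 12, 24, 12:], [:0, 0, -128, -151, -255/4:],
       [:0, 54, 134, 80:], [:63, 99, 75/2:], [:-104, -114:], [:197/4:]:]"

text \<open>The factor \<open>b^2\<close> turns every \<open>t\<close> into \<open>t * b\<close>,
  which the relation replaces by a polynomial in \<open>b\<close> and \<open>h\<close>.\<close>

lemma eval2_pinchuk_sextic:
  fixes t b h :: real
  assumes "t * b = h * b - h^2 * (h + 1)"
  shows "eval2 pinchuk_sextic (h + b, b) = (- (t^2) - 6 * t * h * (h + 1) - eval2 pinchuk_u (b, h)) * b^2"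
proof -
  have "(- (t^2) - 6 * t * h * (h + 1) - eval2 pinchuk_u (b, h)) * b^2
      = - ((t * b)^2) - 6 * (t * b) * b * h * (h + 1) - eval2 pinchuk_u (b, h) * b^2"
    by (simp add: algebra_simps power2_eq_square)
  also have "\<dots> = eval2 pinchuk_sextic (h + b, b)"
    unfolding assms by (simp add: pinchuk_u_def pinchuk_sextic_def) Groebner_Basis.algebra
  finally show ?thesis ..
qed

lemma pinchuk_sextic_relation:
  "pinchuk_Q * pinchuk_f^2 = subst2 pinchuk_sextic pinchuk_P pinchuk_f"
proof (rule eval2_eqI)
  fix z :: "real \<times> real"
  show "eval2 (pinchuk_Q * pinchuk_f^2) z = eval2 (subst2 pinchuk_sextic pinchuk_P pinchuk_f) z"
    using eval2_pinchuk_sextic[OF eval2_pinchuk_t_mult_f[of z]]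
    by (simp add: pinchuk_Q_def pinchuk_P_def pinchuk_q_def add.commute)
qed

lemma eval2_pinchuk_sextic_relation:
  "eval2 pinchuk_sextic (eval2 pinchuk_P z, eval2 pinchuk_f z) = eval2 pinchuk_Q z * (eval2 pinchuk_f z)^2"
  using arg_cong[OF pinchuk_sextic_relation, of "\<lambda>p. eval2 p z"] by simp

lemma pinchuk_level_increasing:
  fixes p b c :: real
  assumes "0 < b" "b < c"
  shows "eval2 pinchuk_sextic (p, b) / b^2 < eval2 pinchuk_sextic (p, c) / c^2"
    and "eval2 pinchuk_sextic (p, - c) / c^2 > eval2 pinchuk_sextic (p, - b) / b^2"
proof -
  \<comment> \<open>With \<open>h = p - b\<close> and \<open>t * b\<close> taken from the relation,
    this is \<open>b^2\<close> times the prescribed Jacobian. The derivative along the level is the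
    Jacobian divided by \<open>b\<close>, so \<open>G b / b^3\<close>, whose sign is that of
    \<open>b\<close>.\<close>
  define G where "G b = ((p - b) * b - (p - b)^2 * (p - b + 1))^2
    + ((p - b) * b - (p - b)^2 * (p - b + 1) + b^2 * (13 + 15 * (p - b)))^2 + b^4" for b
  have G: "G b > 0" if "b \<noteq> 0" for b
    unfolding G_def using that by (intro add_nonneg_pos add_nonneg_nonneg) auto
  have deriv: "((\<lambda>b. eval2 pinchuk_sextic (p, b) / b^2) has_real_derivative G x / x^3) (at x)"
    if "x \<noteq> 0" for x
  proof -
    have *: "eval2 pinchuk_sextic (p, b) = poly (map_poly (\<lambda>c. poly c p) pinchuk_sextic) b" for b
      by (simp add: eval2_conv_slice)
    define M where "M = map_poly (\<lambda>c. poly c p) pinchuk_sextic"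
    have "((\<lambda>b. poly M b / b^2) has_real_derivative
        (poly (pderiv M) x * x^2 - poly M x * (2 * x)) / (x^2 * x^2)) (at x)"
      using that by (auto intro!: derivative_eq_intros)
    moreover have "(poly (pderiv M) x * x^2 - poly M x * (2 * x)) = x * G x"
      unfolding M_def pinchuk_sextic_def G_def
      by (simp add: map_poly_pCons pderiv_pCons) Groebner_Basis.algebra
    moreover have "x * G x / (x^2 * x^2) = G x / x^3"
      using that by (simp add: field_simps power2_eq_square power3_eq_cube)
    ultimately show ?thesis
      by (simp add: * M_def)
  qed
  show "eval2 pinchuk_sextic (p, b) / b^2 < eval2 pinchuk_sextic (p, c) / c^2"
  proof (rule DERIV_pos_imp_increasing[OF \<open>b < c\<close>])
    fix x assume "b \<le> x" "x \<le> c"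
    with assms G[of x] deriv[of x]
    show "\<exists>y. ((\<lambda>b. eval2 pinchuk_sextic (p, b) / b^2) has_real_derivative y) (at x) \<and> y > 0"
      by (intro exI[of _ "G x / x^3"]) auto
  qed
  have "eval2 pinchuk_sextic (p, - c) / (- c)^2 > eval2 pinchuk_sextic (p, - b) / (- b)^2"
  proof (rule DERIV_neg_imp_decreasing[where f = "\<lambda>b. eval2 pinchuk_sextic (p, b) / b^2"])
    show "- c < - b" using assms by simp
    fix x assume "- c \<le> x" "x \<le> - b"
    with assms G[of x] deriv[of x]
    show "\<exists>y. ((\<lambda>b. eval2 pinchuk_sextic (p, b) / b^2) has_real_derivative y) (at x) \<and> y < 0"
      by (intro exI[of _ "G x / x^3"]) (auto intro!: divide_pos_neg)
  qed
  then show "eval2 pinchuk_sextic (p, - c) / c^2 > eval2 pinchuk_sextic (p, - b) / b^2"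
    by simp
qed

lemma card_pinchuk_level:
  assumes "p \<noteq> 0" "p \<noteq> -1"
  shows "card {b. b \<noteq> 0 \<and> eval2 pinchuk_sextic (p, b) = q * b^2} = 2"
proof -
  define c where "c = -((p^2 * (p + 1))^2)"
  have "c < 0"
    using assms by (auto simp: c_def add_eq_0_iff)
  \<comment> \<open>Negative at \<open>0\<close> and positive for large arguments, whatever the
    middle coefficients are.\<close>
  have pos: "\<exists>b>0. poly [:c, d1, d2, d3, d4, d5, 197/4:] b = 0" for d1 d2 d3 d4 d5 :: real
  proof -
    let ?g = "[:c, d1, d2, d3, d4, d5, 197/4:]"
    have "lead_coeff ?g > 0" by simp
    from poly_pinfty_gt_lc[OF this] obtain n where n: "\<And>x. x \<ge> n \<Longrightarrow> poly ?g x \<ge> lead_coeff ?g"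
      by blast
    have "poly ?g (max n 1) > 0"
      using n[of "max n 1"] \<open>lead_coeff ?g > 0\<close> by linarith
    moreover have "poly ?g 0 < 0"
      using \<open>c < 0\<close> by simp
    moreover have "0 < max n 1"
      by simp
    ultimately show ?thesis
      using poly_IVT_pos[of 0 "max n 1" ?g] by blast
  qed
  define M where "M = map_poly (\<lambda>c. poly c p) pinchuk_sextic"
  obtain d where d: "M = [:c, d 1, d 2, d 3, d 4, d (5::nat), 197/4:]"
  proof
    show "M = [:c, coeff M 1, coeff M 2, coeff M 3, coeff M 4, coeff M 5, 197/4:]"
      by (simp add: M_def pinchuk_sextic_def map_poly_pCons c_def numeral_eq_Suc algebra_simps)
  qed
  have M: "eval2 pinchuk_sextic (p, b) = poly M b" for b
    by (simp add: M_def eval2_conv_slice)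
  obtain b1 where b1: "b1 > 0" "poly [:c, d 1, d 2 - q, d 3, d 4, d 5, 197/4:] b1 = 0"
    using pos by blast
  \<comment> \<open>Roots on the negative axis become positive ones under
    \<open>b \<mapsto> - b\<close>, which flips the odd coefficients.\<close>
  obtain b2 where b2: "b2 > 0" "poly [:c, - d 1, d 2 - q, - d 3, d 4, - d 5, 197/4:] b2 = 0"
    using pos by blast
  have e1: "eval2 pinchuk_sextic (p, b1) / b1^2 = q"
  proof -
    have "poly M b1 = poly [:c, d 1, d 2 - q, d 3, d 4, d 5, 197/4:] b1 + q * b1^2"
      unfolding d by (simp add: algebra_simps power2_eq_square)
    with b1 show ?thesis
      by (simp add: M del: poly_pCons)
  qed
  have e2: "eval2 pinchuk_sextic (p, - b2) / b2^2 = q"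
  proof -
    have "poly M (- b2) = poly [:c, - d 1, d 2 - q, - d 3, d 4, - d 5, 197/4:] b2 + q * b2^2"
      unfolding d by (simp add: algebra_simps power2_eq_square)
    with b2 show ?thesis
      by (simp add: M del: poly_pCons)
  qed
  \<comment> \<open>Strict monotonicity on each side of \<open>0\<close> rules out further
    solutions.\<close>
  have "{b. b \<noteq> 0 \<and> eval2 pinchuk_sextic (p, b) = q * b^2} = {b1, - b2}"
  proof (intro Set.set_eqI iffI)
    fix b assume "b \<in> {b. b \<noteq> 0 \<and> eval2 pinchuk_sextic (p, b) = q * b^2}"
    then have b: "b \<noteq> 0" "eval2 pinchuk_sextic (p, b) / b^2 = q"
      by auto
    show "b \<in> {b1, - b2}"
    proof (cases "b > 0")
      case True
      then show ?thesis
        using pinchuk_level_increasing(1)[of b b1 p] pinchuk_level_increasing(1)[of b1 b p] b b1 e1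
        by (cases b b1 rule: linorder_cases) auto
    next
      case False
      define a where "a = - b"
      have "a > 0" "eval2 pinchuk_sextic (p, - a) / a^2 = q"
        using False b by (auto simp: a_def)
      then have "a = b2"
        using pinchuk_level_increasing(2)[of a b2 p] pinchuk_level_increasing(2)[of b2 a p] b2 e2
        by (cases a b2 rule: linorder_cases) auto
      then show ?thesis by (simp add: a_def)
    qed
  next
    fix b assume "b \<in> {b1, - b2}"
    with b1(1) b2(1) e1 e2 have "b \<noteq> 0" "eval2 pinchuk_sextic (p, b) / b^2 = q"
      by auto
    then show "b \<in> {b. b \<noteq> 0 \<and> eval2 pinchuk_sextic (p, b) = q * b^2}"
      by (simp add: divide_eq_eq)
  qed
  moreover have "b1 \<noteq> - b2"
    using b1 b2 by simp
  ultimately show ?thesis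
    by simp
qed

text \<open>
  The curve excluded here is the image of \<open>t = 0\<close> in the \<open>(f, h)\<close>-plane, which no point of the
  \<open>(x, y)\<close>-plane reaches unless \<open>h = 0\<close>: it is parametrised by \<open>s = h + 1\<close> as \<open>p = s\<^sup>2 - 1\<close> and
  \<open>q = - 163/4 + 117/2 s\<^sup>2 - 29 s\<^sup>3 + 345/4 s\<^sup>4 - 75 s\<^sup>5\<close>, and squaring eliminates the odd powers of \<open>s\<close>.
\<close>

lemma card_pinchuk_fibre:
  assumes p: "p \<noteq> 0" "p \<noteq> -1" and q: "q \<noteq> 0"
    and curve: "(q - (-163/4 + 117/2 * (p + 1) + 345/4 * (p + 1)^2))^2
      \<noteq> (p + 1)^3 * (29 + 75 * (p + 1))^2"
  shows "card {z. eval2 pinchuk_P z = p \<and> eval2 pinchuk_Q z = q} = 2"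
proof -
  have t_nz: "t \<noteq> 0"
    if t: "t * b = (p - b) * b - (p - b)^2 * (p - b + 1)"
      and b: "b \<noteq> 0" "eval2 pinchuk_sextic (p, b) = q * b^2" for t b
  proof
    assume "t = 0"
    define h where "h = p - b"
    have "q * b^2 = - eval2 pinchuk_u (b, h) * b^2"
      using eval2_pinchuk_sextic[of t b "p - b"] t b \<open>t = 0\<close> by (simp add: h_def)
    with b(1) have "q = - eval2 pinchuk_u (b, h)"
      by (metis mult_right_cancel power_not_zero)
    \<comment> \<open>\<open>pinchuk_u\<close> vanishes at \<open>h = 0\<close>, so that case would
      give \<open>q = 0\<close>.\<close>
    with q have "h \<noteq> 0"
      by (auto simp: pinchuk_u_def)
    then have bh: "b = h * (h + 1)"
      using t \<open>t = 0\<close> by (simp add: h_def[symmetric] power2_eq_square)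
    then have ph: "p = h * (h + 1) + h"
      by (simp add: h_def)
    have "(q - (-163/4 + 117/2 * (p + 1) + 345/4 * (p + 1)^2))^2
        = (p + 1)^3 * (29 + 75 * (p + 1))^2"
      unfolding ph \<open>q = - eval2 pinchuk_u (b, h)\<close> bh
      by (simp add: pinchuk_u_def) Groebner_Basis.algebra
    with curve show False ..
  qed
  have relation: "eval2 pinchuk_t z * eval2 pinchuk_f z =
      (p - eval2 pinchuk_f z) * eval2 pinchuk_f z - (p - eval2 pinchuk_f z)^2 * (p - eval2 pinchuk_f z + 1)"
    if "eval2 pinchuk_P z = p" for z
    using eval2_pinchuk_t_mult_f[of z] that by (auto simp: pinchuk_P_def)
  \<comment> \<open>On the level \<open>P = p\<close> the value \<open>f = b\<close> fixes
    \<open>h = p - b\<close> and, through the relation, \<open>t\<close>. As \<open>t\<close> is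
    nonzero, there is exactly one such point.\<close>
  have "bij_betw (eval2 pinchuk_f) {z. eval2 pinchuk_P z = p \<and> eval2 pinchuk_Q z = q}
      {b. b \<noteq> 0 \<and> eval2 pinchuk_sextic (p, b) = q * b^2}"
  proof (rule bij_betwI')
    fix z assume "z \<in> {z. eval2 pinchuk_P z = p \<and> eval2 pinchuk_Q z = q}"
    then have z: "eval2 pinchuk_P z = p" "eval2 pinchuk_Q z = q"
      by auto
    have nz: "eval2 pinchuk_f z \<noteq> 0"
    proof
      assume "eval2 pinchuk_f z = 0"
      with relation[OF z(1)] have "p^2 * (p + 1) = 0"
        by simp
      with p show False
        by (simp add: add_eq_0_iff)
    qed
    have M: "eval2 pinchuk_sextic (p, eval2 pinchuk_f z) = q * (eval2 pinchuk_f z)^2"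
      using eval2_pinchuk_sextic_relation[of z] z by simp
    from nz M show "eval2 pinchuk_f z \<in> {b. b \<noteq> 0 \<and> eval2 pinchuk_sextic (p, b) = q * b^2}"
      by simp
    fix z' assume "z' \<in> {z. eval2 pinchuk_P z = p \<and> eval2 pinchuk_Q z = q}"
    then have "eval2 pinchuk_P z' = eval2 pinchuk_P z"
      using z by simp
    then show "eval2 pinchuk_f z = eval2 pinchuk_f z' \<longleftrightarrow> z = z'"
      using pinchuk_point_unique[of z z'] t_nz[OF relation[OF z(1)] nz M] nz
      by (auto simp: pinchuk_P_def)
  next
    fix b assume "b \<in> {b. b \<noteq> 0 \<and> eval2 pinchuk_sextic (p, b) = q * b^2}"
    then have b: "b \<noteq> 0" "eval2 pinchuk_sextic (p, b) = q * b^2"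
      by auto
    define h where "h = p - b"
    define t where "t = h - h^2 * (h + 1) / b"
    have t: "t * b = h * b - h^2 * (h + 1)"
      using b by (simp add: t_def field_simps)
    have "t \<noteq> 0"
      using t_nz[of t b] t b by (simp add: h_def)
    moreover from this have "h \<noteq> 0"
      by (auto simp: t_def)
    ultimately obtain z where z: "eval2 pinchuk_t z = t" "eval2 pinchuk_f z = b" "eval2 pinchuk_h z = h"
      using pinchuk_point[OF b(1) _ _ t] by blast
    have "eval2 pinchuk_P z = p"
      using z by (simp add: pinchuk_P_def h_def)
    moreover from this have "eval2 pinchuk_Q z = q"
      using eval2_pinchuk_sextic_relation[of z] b z by simp
    ultimately have "z \<in> {z. eval2 pinchuk_P z = p \<and> eval2 pinchuk_Q z = q}"
      by simp
    with z show "\<exists>z\<in>{z. eval2 pinchuk_P z = p \<and> eval2 pinchuk_Q z = q}. b = eval2 pinchuk_f z"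
      by blast
  qed
  then show ?thesis
    using card_pinchuk_level[OF p] by (simp add: bij_betw_same_card)
qed

lemma generically_two_to_one_pinchuk:
  "generically_two_to_one (polynomial_map pinchuk_P (pinchuk_Q - subst1 v pinchuk_P))"
proof -
  \<comment> \<open>Undoes the shear: the second component has value \<open>q\<close> at a point
    with \<open>P = p\<close> iff \<open>pinchuk_Q\<close> has value \<open>q + v(p)\<close> there.
    \<open>E\<close> multiplies all the conditions of \<open>card_pinchuk_fibre\<close>.\<close>
  let ?q = "var_y + [:v:]"
  define E where "E = var_x * (var_x + 1) * ?q
    * ((?q - (const2 (-163/4) + const2 (117/2) * (var_x + 1) + const2 (345/4) * (var_x + 1)^2))^2
       - (var_x + 1)^3 * (29 + 75 * (var_x + 1))^2)"
  define U where "U = - {z. \<forall>p\<in>{E}. eval2 p z = 0}"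
  have "zariski_open U"
    unfolding zariski_open_def U_def by blast
  \<comment> \<open>At \<open>p = 1\<close> this choice makes the squared difference in
    \<open>E\<close> zero, while \<open>(p + 1)^3 * (29 + 75 * (p + 1))^2\<close> is not.\<close>
  moreover have "(1, 1685/4 - poly v 1) \<in> U"
    by (simp add: U_def E_def power2_eq_square)
  moreover have "card (polynomial_map pinchuk_P (pinchuk_Q - subst1 v pinchuk_P) -` {w}) = 2"
    if "w \<in> U" for w
  proof -
    obtain p q where w: "w = (p, q)" by force
    have "polynomial_map pinchuk_P (pinchuk_Q - subst1 v pinchuk_P) -` {w} =
        {z. eval2 pinchuk_P z = p \<and> eval2 pinchuk_Q z = q + poly v p}"
      by (auto simp: w polynomial_map_def)
    moreover have "p \<noteq> 0" "p \<noteq> -1" "q + poly v p \<noteq> 0"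
      "(q + poly v p - (-163/4 + 117/2 * (p + 1) + 345/4 * (p + 1)^2))^2
        \<noteq> (p + 1)^3 * (29 + 75 * (p + 1))^2"
      using that by (auto simp: U_def E_def w)
    ultimately show ?thesis
      using card_pinchuk_fibre by simp
  qed
  ultimately show ?thesis
    unfolding generically_two_to_one_def by blast
qed


section \<open>Rational functions in one variable\<close>

lemma poly_eq_0_infinite:
  fixes p :: "real poly"
  assumes "infinite {x. poly p x = 0}"
  shows "p = 0"
  using assms poly_roots_finite by blast

text \<open>The lower bound for the degree of \<open>X\<close> over the field generated by
  \<open>N / D\<close>. The relation is assumed at infinitely many points only, since it will be
  known just at values attained by \<open>f\<close>.\<close>

lemma rational_function_powers_independent:
  fixes N D :: "real poly" and c :: "nat \<Rightarrow> real poly"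
  assumes coprime: "coprime N D" and n: "n \<le> degree N"
    and zero: "infinite {b. poly D b \<noteq> 0 \<and> (\<Sum>i<n. poly (c i) (poly N b / poly D b) * b^i) = 0}"
    and "i < n"
  shows "c i = 0"
proof -
  define m where "m = Max ((degree \<circ> c) ` {..<n})"
  have deg: "degree (c i) \<le> m" if "i < n" for i
    unfolding m_def using that by (intro Max_ge) auto
  \<comment> \<open>Regroups the relation by powers of \<open>N / D\<close>: \<open>B j\<close> is
    the factor of the \<open>j\<close>-th power and has degree below \<open>n\<close>.\<close>
  define B where "B j = (\<Sum>i<n. monom (coeff (c i) j) i)" for j
  have B_coeff: "coeff (B j) i = (if i < n then coeff (c i) j else 0)" for i j
    by (simp add: B_def coeff_sum)
  \<comment> \<open>Clearing the denominator \<open>D ^ m\<close> gives \<open>\<Sum>j. N ^ j * D ^ (m - j) * B j = 0\<close>; modulo \<open>N\<close>, the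
    lowest nonzero \<open>B j\<close> would be divisible by \<open>N\<close>, against the degrees.\<close>
  define T where "T = (\<Sum>j\<le>m. N^j * D^(m - j) * B j)"
  have "poly T b = 0"
    if "poly D b \<noteq> 0" "(\<Sum>i<n. poly (c i) (poly N b / poly D b) * b^i) = 0" for b
  proof -
    let ?N = "poly N b" and ?D = "poly D b"
    have "poly T b = (\<Sum>j\<le>m. \<Sum>i<n. ?N^j * ?D^(m - j) * (coeff (c i) j * b^i))"
      by (simp add: T_def B_def poly_sum poly_monom sum_distrib_left)
    also have "\<dots> = (\<Sum>j\<le>m. \<Sum>i<n. ?D^m * (coeff (c i) j * (?N / ?D)^j * b^i))"
      using that(1) by (intro sum.cong refl) (simp add: power_diff power_divide)
    also have "\<dots> = ?D^m * (\<Sum>i<n. (\<Sum>j\<le>m. coeff (c i) j * (?N / ?D)^j) * b^i)"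
      by (subst sum.swap) (simp add: sum_distrib_left sum_distrib_right)
    also have "(\<Sum>i<n. (\<Sum>j\<le>m. coeff (c i) j * (?N / ?D)^j) * b^i) =
        (\<Sum>i<n. poly (c i) (?N / ?D) * b^i)"
    proof (intro sum.cong refl)
      fix i assume "i \<in> {..<n}"
      then have "(\<Sum>j\<le>m. monom (coeff (c i) j) j) = c i"
        by (intro poly_as_sum_of_monoms' deg) simp
      then have "poly (\<Sum>j\<le>m. monom (coeff (c i) j) j) (?N / ?D) = poly (c i) (?N / ?D)"
        by (rule arg_cong)
      then show "(\<Sum>j\<le>m. coeff (c i) j * (?N / ?D)^j) * b^i = poly (c i) (?N / ?D) * b^i"
        by (simp add: poly_sum poly_monom)
    qed
    finally show ?thesis
      using that(2) by simp
  qed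
  then have "{b. poly D b \<noteq> 0 \<and> (\<Sum>i<n. poly (c i) (poly N b / poly D b) * b^i) = 0}
      \<subseteq> {b. poly T b = 0}"
    by blast
  with zero have "T = 0"
    using poly_eq_0_infinite infinite_super by blast
  have "N \<noteq> 0"
    using n \<open>i < n\<close> by auto
  have "B j = 0" if "j \<le> m" for j
    using that
  proof (induction j rule: less_induct)
    case (less j)
    have "T = (\<Sum>i\<in>{j..m}. N^i * D^(m - i) * B i)"
      unfolding T_def using less by (intro sum.mono_neutral_right) auto
    also have "\<dots> = (\<Sum>i\<in>{j..m}. N^j * (N^(i - j) * D^(m - i) * B i))"
      by (intro sum.cong refl) (simp flip: power_add mult.assoc)
    also have "\<dots> = N^j * (\<Sum>i\<in>{j..m}. N^(i - j) * D^(m - i) * B i)"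
      by (simp add: sum_distrib_left)
    finally have "(\<Sum>i\<in>{j..m}. N^(i - j) * D^(m - i) * B i) = 0"
      using \<open>T = 0\<close> \<open>N \<noteq> 0\<close> by simp
    also have "(\<Sum>i\<in>{j..m}. N^(i - j) * D^(m - i) * B i) =
        D^(m - j) * B j + (\<Sum>i\<in>{Suc j..m}. N^(i - j) * D^(m - i) * B i)"
      using less.prems by (simp add: sum.atLeast_Suc_atMost)
    finally have "D^(m - j) * B j = - (\<Sum>i\<in>{Suc j..m}. N^(i - j) * D^(m - i) * B i)"
      by (simp add: eq_neg_iff_add_eq_0)
    moreover have "N dvd (\<Sum>i\<in>{Suc j..m}. N^(i - j) * D^(m - i) * B i)"
      by (intro dvd_sum dvd_mult2) (simp add: dvd_power)
    ultimately have "N dvd D^(m - j) * B j"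
      by simp
    then have "N dvd B j"
      using coprime by (simp add: coprime_dvd_mult_right_iff)
    show "B j = 0"
    proof (rule ccontr)
      assume "B j \<noteq> 0"
      with \<open>N dvd B j\<close> have "degree N \<le> degree (B j)"
        by (rule dvd_imp_degree_le)
      moreover have "degree (B j) < n"
        using \<open>i < n\<close> by (intro le_less_trans[OF degree_le[of "n - 1"]]) (auto simp: B_coeff)
      ultimately show False
        using n by simp
    qed
  qed
  then have "coeff (c i) j = 0" if "j \<le> m" for j
    using B_coeff[of j i] \<open>i < n\<close> that by simp
  moreover have "coeff (c i) j = 0" if "j > m" for j
    using deg[OF \<open>i < n\<close>] that by (simp add: coeff_eq_0)
  ultimately show ?thesis
    by (simp add: poly_eq_iff) (meson not_le)
qed

text \<open>
  The equation says that the Laurent polynomial \<open>M / X\<^sup>2\<close> takes the same value at \<open>A / B\<close> and at \<open>X\<close>,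
  with denominators cleared.
\<close>

lemma Laurent_root_unique_coprime:
  fixes M A B :: "real poly"
  assumes c: "coeff M 0 \<noteq> 0" "coeff M 1 \<noteq> 0" "coeff M 6 \<noteq> 0" and coprime: "coprime A B"
    and eq: "M * A^2 * B^4 = [:0, 1:]^2 * (\<Sum>i\<le>6. smult (coeff M i) (A^i * B^(6 - i)))"
  shows "A = [:0, 1:] * B"
proof -
  define H where "H = (\<Sum>i\<le>6. smult (coeff M i) (A^i * B^(6 - i)))"
  have X: "[:0, 1:]^2 = (monom 1 2 :: real poly)"
    by (simp add: monom_altdef)
  \<comment> \<open>Modulo \<open>A\<close> only the term \<open>i = 0\<close> of \<open>H\<close>
    survives, a nonzero multiple of \<open>B^6\<close>; modulo \<open>B\<close>, below, only a
    nonzero multiple of \<open>A^6\<close>.\<close>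
  have "coprime A H"
  proof (rule coprimeI)
    fix d assume d: "d dvd A" "d dvd H"
    have "H = smult (coeff M 0) (B^6) + (\<Sum>i\<in>{1..6}. smult (coeff M i) (A^i * B^(6 - i)))"
      unfolding H_def atMost_atLeast0 by (subst sum.atLeast_Suc_atMost) simp_all
    moreover have "d dvd (\<Sum>i\<in>{1..6}. smult (coeff M i) (A^i * B^(6 - i)))"
      by (intro dvd_sum dvd_smult dvd_mult2 dvd_trans[OF d(1) dvd_power]) auto
    ultimately have "d dvd smult (coeff M 0) (B^6)"
      using d(2) by (simp only: dvd_add_left_iff)
    then have "d dvd B^6"
      using c(1) by (simp add: dvd_smult_iff)
    moreover have "coprime A (B^6)"
      using coprime by simp
    ultimately show "is_unit d"
      using d(1) by (meson coprime_common_divisor)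
  qed
  have "coprime B H"
  proof (rule coprimeI)
    fix d assume d: "d dvd B" "d dvd H"
    have "H = smult (coeff M 6) (A^6) + (\<Sum>i<6. smult (coeff M i) (A^i * B^(6 - i)))"
      by (simp add: H_def lessThan_Suc_atMost[symmetric] flip: Suc_numeral)
    moreover have "d dvd (\<Sum>i<6. smult (coeff M i) (A^i * B^(6 - i)))"
      by (intro dvd_sum dvd_smult dvd_mult dvd_trans[OF d(1) dvd_power]) auto
    ultimately have "d dvd smult (coeff M 6) (A^6)"
      using d(2) by (simp only: dvd_add_left_iff)
    then have "d dvd A^6"
      using c(3) by (simp add: dvd_smult_iff)
    moreover have "coprime B (A^6)"
      using coprime by (simp add: coprime_commute)
    ultimately show "is_unit d"
      using d(1) by (meson coprime_common_divisor)
  qed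
  have eq': "M * A^2 * B^4 = monom 1 2 * H"
    using eq by (simp add: H_def X)
  have "A^2 dvd monom 1 2 * H" "B^4 dvd monom 1 2 * H"
    unfolding eq'[symmetric] by simp_all
  \<comment> \<open>Both powers divide \<open>X^2\<close>, which forces \<open>A\<close> to be at
    most linear and \<open>B\<close> to be constant.\<close>
  then have dvd: "A^2 dvd monom 1 2" "B^4 dvd monom 1 2"
    using \<open>coprime A H\<close> \<open>coprime B H\<close> by (simp_all add: coprime_dvd_mult_left_iff)
  have nz: "A \<noteq> 0" "B \<noteq> 0"
    using dvd by (auto simp: monom_eq_0_iff power_0_left)
  have "degree (A^2) \<le> 2" "degree (B^4) \<le> 2"
    using dvd[THEN dvd_imp_degree_le] by (simp_all add: degree_monom_eq)
  then have "degree A \<le> 1" "degree B = 0"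
    using nz by (simp_all add: degree_power_eq)
  obtain \<beta> where B: "B = [:\<beta>:]"
    using \<open>degree B = 0\<close> by (rule degree_eq_zeroE)
  have \<beta>: "\<beta> \<noteq> 0"
    using nz B by auto
  obtain a0 a1 where A: "A = [:a0, a1:]"
    using \<open>degree A \<le> 1\<close> by (metis One_nat_def degree1_coeffs degree_eq_zeroE le_SucE le_zero_eq pCons_0_0)
  have "poly (M * A^2 * B^4) 0 = poly (monom 1 2 * H) 0"
    by (simp only: eq')
  then have "a0 = 0"
    using c(1) \<beta> by (simp add: A B poly_monom flip: poly_0_coeff_0)
  have "A^i * B^(6 - i) = monom (a1^i * \<beta>^(6 - i)) i" for i
  proof -
    have "A = monom a1 1"
      by (simp add: A \<open>a0 = 0\<close> monom_altdef)
    then show ?thesis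
      by (simp add: B monom_power poly_const_pow mult_monom smult_monom mult.commute)
  qed
  then have H: "H = (\<Sum>i\<le>6. monom (coeff M i * (a1^i * \<beta>^(6 - i))) i)"
    by (simp add: H_def smult_monom)
  have "M * A^2 * B^4 = monom 1 2 * smult (a1^2 * \<beta>^4) M"
    by (simp add: A B \<open>a0 = 0\<close> poly_const_pow monom_altdef power2_eq_square mult_ac)
  then have "monom 1 2 * H = monom 1 2 * smult (a1^2 * \<beta>^4) M"
    by (simp only: eq')
  then have "H = smult (a1^2 * \<beta>^4) M"
    unfolding mult_cancel_left by (simp add: monom_eq_0_iff)
  \<comment> \<open>The constant coefficients give \<open>a1 = \<beta>\<close> up to sign; the
    linear ones, nonzero by assumption, settle the sign.\<close>
  then have "coeff H 0 = a1^2 * \<beta>^4 * coeff M 0" "coeff H 1 = a1^2 * \<beta>^4 * coeff M 1"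
    by simp_all
  then have "coeff M 0 * \<beta>^6 = a1^2 * \<beta>^4 * coeff M 0" "coeff M 1 * (a1 * \<beta>^5) = a1^2 * \<beta>^4 * coeff M 1"
    by (simp_all add: H coeff_sum)
  then have "\<beta>^6 = a1^2 * \<beta>^4" "a1 * \<beta>^5 = a1^2 * \<beta>^4"
    using c by auto
  then have "a1 = \<beta>"
    using \<beta> nz A \<open>a0 = 0\<close> by (auto simp: power_numeral_reduce)
  then show ?thesis
    by (simp add: A B \<open>a0 = 0\<close>)
qed

text \<open>Both sides are homogeneous of degree six in \<open>A\<close> and \<open>B\<close>, so
  their gcd cancels.\<close>

lemma Laurent_root_unique:
  fixes M A B :: "real poly"
  assumes c: "coeff M 0 \<noteq> 0" "coeff M 1 \<noteq> 0" "coeff M 6 \<noteq> 0" and "B \<noteq> 0"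
    and eq: "M * A^2 * B^4 = [:0, 1:]^2 * (\<Sum>i\<le>6. smult (coeff M i) (A^i * B^(6 - i)))"
  shows "A = [:0, 1:] * B"
proof -
  define g where "g = gcd A B"
  have "g \<noteq> 0"
    using \<open>B \<noteq> 0\<close> by (simp add: g_def)
  obtain A' B' where AB: "A = A' * g" "B = B' * g" "coprime A' B'"
    using gcd_coprime_exists[of A B] \<open>g \<noteq> 0\<close> unfolding g_def by blast
  have "g^6 * (M * A'^2 * B'^4) = M * A^2 * B^4"
    by (simp add: AB power_mult_distrib mult_ac flip: power_add)
  also have "\<dots> = g^6 * ([:0, 1:]^2 * (\<Sum>i\<le>6. smult (coeff M i) (A'^i * B'^(6 - i))))"
  proof -
    have "A^i * B^(6 - i) = g^6 * (A'^i * B'^(6 - i))" if "i \<le> 6" for i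
      using that by (simp add: AB power_mult_distrib mult_ac flip: power_add)
    then have "(\<Sum>i\<le>6. smult (coeff M i) (A^i * B^(6 - i))) =
        (\<Sum>i\<le>6. g^6 * smult (coeff M i) (A'^i * B'^(6 - i)))"
      by (intro sum.cong) auto
    then show ?thesis
      unfolding eq by (simp only: sum_distrib_left mult.left_commute)
  qed
  finally have "A' = [:0, 1:] * B'"
    using \<open>g \<noteq> 0\<close> by (intro Laurent_root_unique_coprime[OF c AB(3)]) simp
  then show ?thesis
    by (simp add: AB)
qed


section \<open>Subfields of the field of rational functions\<close>

lemma ring_of_type_algebra_simps [simp]:
  "carrier ring_of_type_algebra = UNIV"
  "x \<otimes>\<^bsub>ring_of_type_algebra\<^esub> y = x * y" "x \<oplus>\<^bsub>ring_of_type_algebra\<^esub> y = x + y"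
  "\<one>\<^bsub>ring_of_type_algebra\<^esub> = 1" "\<zero>\<^bsub>ring_of_type_algebra\<^esub> = 0"
  by (simp_all add: ring_of_type_algebra_def)

lemma a_inv_type_algebra [simp]: "\<ominus>\<^bsub>ring_of_type_algebra\<^esub> x = - (x :: 'a :: comm_ring_1)"
proof -
  interpret R: cring "ring_of_type_algebra :: 'a ring" ..
  show ?thesis
    using R.minus_equality[of "- x" x] by simp
qed

lemma m_inv_type_algebra: "x \<noteq> 0 \<Longrightarrow> inv\<^bsub>ring_of_type_algebra\<^esub> x = inverse (x :: 'a :: field)"
proof -
  interpret R: field "ring_of_type_algebra :: 'a ring" ..
  assume "x \<noteq> 0"
  then show ?thesis
    using R.comm_inv_char[of x "inverse x"] by simp
qed

lemma nat_pow_type_algebra [simp]: "x [^]\<^bsub>ring_of_type_algebra\<^esub> (n::nat) = (x :: 'a :: comm_ring_1) ^ n"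
proof -
  interpret R: cring "ring_of_type_algebra :: 'a ring" ..
  show ?thesis
    by (induction n) (simp_all add: mult.commute)
qed

lemma subfield_type_algebraI:
  fixes K :: "'a :: field set"
  assumes "1 \<in> K" and "\<And>x y. x \<in> K \<Longrightarrow> y \<in> K \<Longrightarrow> x + y \<in> K" and "\<And>x. x \<in> K \<Longrightarrow> - x \<in> K"
    and "\<And>x y. x \<in> K \<Longrightarrow> y \<in> K \<Longrightarrow> x * y \<in> K" and "\<And>x. x \<in> K \<Longrightarrow> x \<noteq> 0 \<Longrightarrow> inverse x \<in> K"
  shows "subfield K ring_of_type_algebra"
proof -
  interpret R: field "ring_of_type_algebra :: 'a ring" ..
  show ?thesis
    by (intro R.subfieldI' R.subringI) (auto simp: assms m_inv_type_algebra)
qed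

lemma subfield_type_algebraD:
  fixes K :: "'a :: field set"
  assumes "subfield K ring_of_type_algebra"
  shows "0 \<in> K" "1 \<in> K" "x \<in> K \<Longrightarrow> y \<in> K \<Longrightarrow> x + y \<in> K" "x \<in> K \<Longrightarrow> - x \<in> K"
    "x \<in> K \<Longrightarrow> y \<in> K \<Longrightarrow> x * y \<in> K" "x \<in> K \<Longrightarrow> inverse x \<in> K"
    "x \<in> K \<Longrightarrow> y \<in> K \<Longrightarrow> x - y \<in> K" "x \<in> K \<Longrightarrow> y \<in> K \<Longrightarrow> x / y \<in> K"
    "x \<in> K \<Longrightarrow> x ^ n \<in> K" "numeral w \<in> K"
proof -
  interpret R: field "ring_of_type_algebra :: 'a ring" ..
  have sub: "subring K ring_of_type_algebra"
    using assms by (rule subfieldE)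
  show zero: "0 \<in> K" and one: "1 \<in> K"
    using subringE(2,3)[OF sub] by simp_all
  show add: "x \<in> K \<Longrightarrow> y \<in> K \<Longrightarrow> x + y \<in> K" for x y
    using subringE(7)[OF sub, of x y] by simp
  show uminus: "x \<in> K \<Longrightarrow> - x \<in> K" for x
    using subringE(5)[OF sub, of x] by simp
  show mult: "x \<in> K \<Longrightarrow> y \<in> K \<Longrightarrow> x * y \<in> K" for x y
    using subringE(6)[OF sub, of x y] by simp
  \<comment> \<open>Holds for \<open>x = 0\<close> too, as \<open>inverse 0 = 0\<close>.\<close>
  show inv: "x \<in> K \<Longrightarrow> inverse x \<in> K" for x
    using R.subfield_m_inv(1)[OF assms, of x] zero m_inv_type_algebra[of x] by (cases "x = 0") auto
  show "x \<in> K \<Longrightarrow> y \<in> K \<Longrightarrow> x - y \<in> K"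
    using add[of x "- y"] uminus[of y] by simp
  show "x \<in> K \<Longrightarrow> y \<in> K \<Longrightarrow> x / y \<in> K"
    using mult[of x "inverse y"] inv[of y] by (simp add: divide_inverse)
  show "x \<in> K \<Longrightarrow> x ^ n \<in> K"
    by (induction n) (auto intro: one mult)
  have "of_nat n \<in> K" for n
    by (induction n) (auto intro: zero one add)
  from this[of "numeral w"] show "numeral w \<in> K"
    by simp
qed

lemma adjoin_subfield: "subfield (adjoin k S) real_rat_functions"
proof -
  interpret R: field real_rat_functions ..
  show ?thesis
    unfolding adjoin_def by (rule R.generate_field_is_subfield) simp
qed

lemma adjoin_minimal:
  assumes "subfield E real_rat_functions" "\<And>c. c \<in> k \<Longrightarrow> to_fract (const2 c) \<in> E"
    and "\<And>s. s \<in> S \<Longrightarrow> to_fract s \<in> E"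
  shows "adjoin k S \<subseteq> E"
proof -
  interpret R: field real_rat_functions ..
  show ?thesis
    unfolding adjoin_def using assms by (intro R.generate_field_min_subfield1) auto
qed

lemma adjoin_const: "c \<in> k \<Longrightarrow> to_fract (const2 c) \<in> adjoin k S"
  unfolding adjoin_def by (rule generate_field.incl) simp

lemma adjoin_gen: "s \<in> S \<Longrightarrow> to_fract s \<in> adjoin k S"
  unfolding adjoin_def by (rule generate_field.incl) simp

lemma to_fract_power: "to_fract (x ^ n) = to_fract x ^ n"
  by (induction n) simp_all

section \<open>Explicit fractions and generators of the function field\<close>

lemma fract_cases:
  obtains a b where "b \<noteq> 0" "z = to_fract a / to_fract b"
  by (cases z) (auto simp: Fract_conv_to_fract)

text \<open>The field generated by \<open>a\<close> and \<open>b\<close> over all reals, with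
  explicit numerators and denominators. Its constants do not depend on \<open>k\<close>, so one
  independence result serves every \<open>k\<close>.\<close>

definition composites ::
    "real poly poly \<Rightarrow> real poly poly \<Rightarrow> real poly poly fract set" where
  "composites a b = {to_fract (subst2 c a b) / to_fract (subst2 d a b) | c d. subst2 d a b \<noteq> 0}"

lemma compositesI: "subst2 d a b \<noteq> 0 \<Longrightarrow> to_fract (subst2 c a b) / to_fract (subst2 d a b) \<in> composites a b"
  unfolding composites_def by blast

lemma compositesI1: "to_fract (subst2 c a b) \<in> composites a b"
  using compositesI[of 1 a b c] by (simp add: subst2_simps)

lemma subfield_composites: "subfield (composites a b) real_rat_functions"
proof (rule subfield_type_algebraI)
  show "1 \<in> composites a b"
    using compositesI1[of 1 a b] by (simp add: subst2_simps)
next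
  fix x y assume "x \<in> composites a b" "y \<in> composites a b"
  then obtain c d c' d' where
    x: "x = to_fract (subst2 c a b) / to_fract (subst2 d a b)" "subst2 d a b \<noteq> 0" and
    y: "y = to_fract (subst2 c' a b) / to_fract (subst2 d' a b)" "subst2 d' a b \<noteq> 0"
    unfolding composites_def by blast
  have "x + y = to_fract (subst2 (c * d' + c' * d) a b) / to_fract (subst2 (d * d') a b)"
    using x y by (simp add: subst2_simps add_frac_eq)
  moreover have "subst2 (d * d') a b \<noteq> 0"
    using x(2) y(2) by (simp add: subst2_simps)
  ultimately show "x + y \<in> composites a b"
    by (metis compositesI)
  have "x * y = to_fract (subst2 (c * c') a b) / to_fract (subst2 (d * d') a b)"
    using x y by (simp add: subst2_simps)
  with \<open>subst2 (d * d') a b \<noteq> 0\<close> show "x * y \<in> composites a b"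
    by (metis compositesI)
next
  fix x assume "x \<in> composites a b"
  then obtain c d where
    x: "x = to_fract (subst2 c a b) / to_fract (subst2 d a b)" "subst2 d a b \<noteq> 0"
    unfolding composites_def by blast
  have "- x = to_fract (subst2 (- c) a b) / to_fract (subst2 d a b)"
    using x by (simp add: subst2_simps)
  with x(2) show "- x \<in> composites a b"
    by (metis compositesI)
  assume "x \<noteq> 0"
  then have "subst2 c a b \<noteq> 0"
    using x by auto
  then show "inverse x \<in> composites a b"
    using x compositesI[of c a b d] by simp
qed

lemma composites_generators:
  "to_fract (const2 c) \<in> composites a b" "to_fract a \<in> composites a b" "to_fract b \<in> composites a b"
  using compositesI1[of "const2 c" a b] compositesI1[of var_x a b] compositesI1[of var_y a b]
  by (simp_all add: subst2_simps)

lemma subst1_in_subfield: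
  assumes K: "subfield K real_rat_functions" and "\<And>c. c \<in> k \<Longrightarrow> to_fract (const2 c) \<in> K"
    and "to_fract a \<in> K" and "\<And>j. coeff v j \<in> k"
  shows "to_fract (subst1 v a) \<in> K"
  using assms(4)
proof (induction v)
  case 0
  then show ?case
    by (simp add: subfield_type_algebraD[OF K])
next
  case (pCons c v)
  have "c \<in> k" "coeff v j \<in> k" for j
    using pCons.prems[of 0] pCons.prems[of "Suc j"] by simp_all
  then show ?case
    using pCons.IH assms(2,3) by (simp add: subst1_pCons subfield_type_algebraD[OF K])
qed

lemma polynomial_in_subfield:
  assumes K: "subfield K real_rat_functions" and k: "\<And>c. c \<in> k \<Longrightarrow> to_fract (const2 c) \<in> K"
    and "to_fract var_x \<in> K" "to_fract var_y \<in> K" and "\<And>i j. coeff (coeff p j) i \<in> k"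
  shows "to_fract p \<in> K"
  using assms(5)
proof (induction p)
  case 0
  then show ?case
    by (simp add: subfield_type_algebraD[OF K])
next
  case (pCons c p)
  have coeffs: "coeff c i \<in> k" "coeff (coeff p j) i \<in> k" for i j
    using pCons.prems[of 0 i] pCons.prems[of "Suc j" i] by simp_all
  have "to_fract (pCons c p) = to_fract (subst1 c var_x + var_y * p)"
    by (intro arg_cong[where f = to_fract] eval2_eqI) simp
  with coeffs assms(3,4) pCons.IH show ?case
    by (simp add: subfield_type_algebraD[OF K] subst1_in_subfield[OF K k])
qed

lemma subfield_contains_polynomials:
  assumes K: "subfield K real_rat_functions" and "\<And>c. to_fract (const2 c) \<in> K"
    and "to_fract var_x \<in> K" "to_fract var_y \<in> K"
  shows "K = UNIV"
proof -
  have "to_fract p \<in> K" for p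
    by (rule polynomial_in_subfield[of K UNIV]) (simp_all add: assms)
  then have "z \<in> K" for z
    by (cases z rule: fract_cases) (simp add: subfield_type_algebraD[OF K])
  then show ?thesis
    by blast
qed

lemma pinchuk_f_nonzero: "pinchuk_f \<noteq> 0" and pinchuk_t_nonzero: "pinchuk_t \<noteq> 0"
proof -
  have "eval2 pinchuk_f (0, 0) \<noteq> 0" "eval2 pinchuk_t (0, 0) \<noteq> 0"
    by (simp_all add: pinchuk_f_def pinchuk_t_def)
  then show "pinchuk_f \<noteq> 0" "pinchuk_t \<noteq> 0"
    by auto
qed

text \<open>Successively \<open>h = P - f\<close>, \<open>t = (t * f) / f\<close>,
  \<open>x = (h - t) / t^2\<close> and \<open>y = (t + 1) / x\<close>. No real constants enter, so
  this applies over any \<open>k\<close> and to fixed fields of automorphisms.\<close>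

lemma subfield_contains_x_y:
  assumes K: "subfield K real_rat_functions" and "to_fract pinchuk_P \<in> K" "to_fract pinchuk_f \<in> K"
  shows "to_fract var_x \<in> K" "to_fract var_y \<in> K"
proof -
  note closed = subfield_type_algebraD[OF K]
  let ?F = "to_fract pinchuk_f" and ?T = "to_fract pinchuk_t"
  have nz: "?F \<noteq> 0" "?T \<noteq> 0" "to_fract var_x \<noteq> 0"
    by (simp_all add: pinchuk_f_nonzero pinchuk_t_nonzero var_x_def)
  have H: "to_fract pinchuk_h \<in> K"
    using closed(7)[OF assms(2,3)] by (simp add: pinchuk_P_def)
  have "to_fract (pinchuk_t * pinchuk_f) \<in> K"
    unfolding pinchuk_t_mult_f by (auto intro!: closed H assms simp: to_fract_power)
  from closed(8)[OF this assms(3)] have T: "?T \<in> K"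
    using nz by simp
  have "to_fract var_x = to_fract (pinchuk_h - pinchuk_t) / ?T^2"
  proof -
    have "pinchuk_h - pinchuk_t = var_x * pinchuk_t^2"
      by (simp add: pinchuk_h_def algebra_simps power2_eq_square)
    with nz show ?thesis
      by (simp add: to_fract_power)
  qed
  then show X: "to_fract var_x \<in> K"
    by (auto intro!: closed H T)
  have "to_fract var_y = (?T + 1) / to_fract var_x"
  proof -
    have "?T + 1 = to_fract (pinchuk_t + 1)"
      by simp
    also have "pinchuk_t + 1 = var_x * var_y"
      by (simp add: pinchuk_t_def)
    finally show ?thesis
      using nz by simp
  qed
  then show "to_fract var_y \<in> K"
    by (auto intro!: closed X T)
qed

lemma composites_P_f: "composites pinchuk_P pinchuk_f = UNIV"
  by (intro subfield_contains_polynomials subfield_composites composites_generators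
      subfield_contains_x_y[OF subfield_composites])

lemma pinchuk_P_f_points:
  "finite {b. \<nexists>z. eval2 pinchuk_P z = p \<and> eval2 pinchuk_f z = b}"
proof -
  \<comment> \<open>The factors are \<open>b\<close>, \<open>h = p - b\<close> and
    \<open>b - h * (h + 1)\<close>; the last two multiply to \<open>t * b\<close>.\<close>
  let ?g = "[:0, 1:] * [:p, -1:] * ([:0, 1:] - [:p, -1:] * [:p + 1, -1:])"
  have "{b. \<nexists>z. eval2 pinchuk_P z = p \<and> eval2 pinchuk_f z = b} \<subseteq> {b. poly ?g b = 0}"
  proof safe
    fix b assume no: "\<nexists>z. eval2 pinchuk_P z = p \<and> eval2 pinchuk_f z = b"
    show "poly ?g b = 0"
    proof (rule ccontr)
      assume "poly ?g b \<noteq> 0"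
      moreover have "poly ?g b = b * (p - b) * (b - (p - b) * (p + 1 - b))"
        by (simp add: algebra_simps)
      ultimately have "b * (p - b) * (b - (p - b) * (p + 1 - b)) \<noteq> 0"
        by metis
      then have b: "b \<noteq> 0" "p - b \<noteq> 0" "(p - b) * (b - (p - b) * (p + 1 - b)) \<noteq> 0"
        by auto
      define h where "h = p - b"
      define t where "t = h - h^2 * (h + 1) / b"
      have t: "t * b = h * b - h^2 * (h + 1)"
        using b by (simp add: t_def field_simps)
      have "(p - b) * (b - (p - b) * (p + 1 - b)) = h * b - h^2 * (h + 1)"
        by (simp add: h_def algebra_simps power2_eq_square)
      then have "t * b \<noteq> 0"
        using b(3) t by simp
      then have "t \<noteq> 0"
        by simp
      moreover have "h \<noteq> 0"
        using b by (simp add: h_def)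
      ultimately obtain z where "eval2 pinchuk_f z = b" "eval2 pinchuk_h z = h"
        using pinchuk_point[OF b(1) _ _ t] by blast
      then have "eval2 pinchuk_P z = p \<and> eval2 pinchuk_f z = b"
        by (simp add: pinchuk_P_def h_def)
      with no show False by blast
    qed
  qed
  moreover have "?g \<noteq> 0"
    by simp
  then have "finite {b. poly ?g b = 0}"
    by (rule poly_roots_finite)
  ultimately show ?thesis
    by (rule finite_subset)
qed

text \<open>Algebraic independence of \<open>P\<close> and \<open>f\<close>: on each level of
  \<open>P\<close>, \<open>f\<close> takes all but finitely many values.\<close>

lemma subst2_P_f_eq_0:
  assumes "subst2 w pinchuk_P pinchuk_f = 0"
  shows "w = 0"
proof (rule eval2_eq_0_cofinite[of "{}"])
  fix p :: real
  have "eval2 w (p, b) = 0" if "\<exists>z. eval2 pinchuk_P z = p \<and> eval2 pinchuk_f z = b" for b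
  proof -
    from that obtain z where "eval2 pinchuk_P z = p" "eval2 pinchuk_f z = b" by blast
    then have "eval2 w (p, b) = eval2 (subst2 w pinchuk_P pinchuk_f) z"
      by simp
    with assms show ?thesis by simp
  qed
  then show "finite {b. eval2 w (p, b) \<noteq> 0}"
    by (intro finite_subset[OF _ pinchuk_P_f_points[of p]]) blast
qed simp

lemma poly_slice: "poly (map_poly (\<lambda>c. poly c p) w) b = eval2 w (p, b)"
  by (simp add: eval2_conv_slice)

lemma sextic_slice_coeffs:
  defines "M \<equiv> \<lambda>p. map_poly (\<lambda>c. poly c p) pinchuk_sextic"
  shows "coeff (M p) 0 = - ((p^2 * (p + 1))^2)" "coeff (M p) 1 = 12 * p^3 * (p + 1)^2"
    "coeff (M p) 6 = 197/4" "degree (M p) = 6"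
  by (simp_all add: M_def pinchuk_sextic_def map_poly_pCons numeral_eq_Suc algebra_simps)

text \<open>On a level \<open>P = p\<close> the relation becomes one between powers of
  \<open>b = f\<close> over polynomials in \<open>N / b^2\<close>. For \<open>p\<close> other than
  \<open>0\<close> and \<open>-1\<close>, \<open>N\<close> has nonzero constant term, hence is
  coprime to \<open>b^2\<close>.\<close>

lemma pinchuk_powers_independent:
  assumes zero: "(\<Sum>i<6. subst2 (c i) pinchuk_P pinchuk_Q * pinchuk_f^i) = 0" and "i < 6"
  shows "c i = 0"
proof (rule eval2_eq_0_cofinite)
  show "finite {0, -1::real}" by simp
  fix p :: real assume p: "p \<notin> {0, -1}"
  let ?slice = "map_poly (\<lambda>c. poly c p)"
  define N where "N = ?slice pinchuk_sextic"
  define D :: "real poly" where "D = [:0, 1:]^2"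
  have "poly N 0 \<noteq> 0"
    using p by (auto simp: N_def poly_0_coeff_0 sextic_slice_coeffs add_eq_0_iff)
  then have "\<not> [:0, 1:] dvd N"
    using poly_eq_0_iff_dvd[of N 0] by simp
  then have "coprime [:0, 1:] N"
    by (intro prime_elem_imp_coprime prime_elem_linear_field_poly) simp_all
  then have "coprime N D"
    by (simp add: D_def coprime_commute)
  moreover have "6 \<le> degree N"
    by (simp add: N_def sextic_slice_coeffs)
  moreover have "infinite {b. poly D b \<noteq> 0 \<and> (\<Sum>i<6. poly (?slice (c i)) (poly N b / poly D b) * b^i) = 0}"
  proof (rule infinite_super)
    show "infinite (UNIV - ({0} \<union> {b. \<nexists>z. eval2 pinchuk_P z = p \<and> eval2 pinchuk_f z = b}))"
      using pinchuk_P_f_points by (intro Diff_infinite_finite infinite_UNIV_char_0) simp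
    show "UNIV - ({0} \<union> {b. \<nexists>z. eval2 pinchuk_P z = p \<and> eval2 pinchuk_f z = b})
      \<subseteq> {b. poly D b \<noteq> 0 \<and> (\<Sum>i<6. poly (?slice (c i)) (poly N b / poly D b) * b^i) = 0}"
    proof safe
      fix b z assume b: "b \<notin> {}" "eval2 pinchuk_f z \<noteq> 0" "p = eval2 pinchuk_P z"
      have "eval2 pinchuk_Q z = poly N (eval2 pinchuk_f z) / poly D (eval2 pinchuk_f z)"
        using b eval2_pinchuk_sextic_relation[of z] by (simp add: N_def D_def poly_slice field_simps)
      moreover have "eval2 (\<Sum>i<6. subst2 (c i) pinchuk_P pinchuk_Q * pinchuk_f^i) z = 0"
        using zero by simp
      ultimately show "(\<Sum>i<6. poly (map_poly (\<lambda>c. poly c (eval2 pinchuk_P z)) (c i))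
          (poly N (eval2 pinchuk_f z) / poly D (eval2 pinchuk_f z)) * eval2 pinchuk_f z^i) = 0"
        by (simp add: eval2_sum poly_slice)
    qed (auto simp: D_def)
  qed
  ultimately have "?slice (c i) = 0"
    using \<open>i < 6\<close> by (rule rational_function_powers_independent)
  then have "eval2 (c i) (p, b) = 0" for b
    by (simp add: eval2_conv_slice)
  then show "finite {b. eval2 (c i) (p, b) \<noteq> 0}"
    by simp
qed

lemma sextic_root_unique:
  assumes "B \<noteq> 0"
    and eq: "pinchuk_sextic * A^2 * B^4 = var_y^2 * (\<Sum>i\<le>6. [:coeff pinchuk_sextic i:] * A^i * B^(6 - i))"
  shows "A = var_y * B"
proof -
  let ?slice = "\<lambda>p. map_poly (\<lambda>c. poly c p)"
  obtain j where "coeff B j \<noteq> 0"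
    using \<open>B \<noteq> 0\<close> by (metis leading_coeff_0_iff)
  \<comment> \<open>Off \<open>S\<close> the slice of \<open>B\<close> is nonzero and the sextic has
    nonzero coefficients in degrees 0 and 1, as \<open>Laurent_root_unique\<close> requires.\<close>
  define S where "S = {0, -1} \<union> {p. poly (coeff B j) p = 0}"
  have "A - var_y * B = 0"
  proof (rule eval2_eq_0_cofinite)
    show "finite S"
      using \<open>coeff B j \<noteq> 0\<close> by (simp add: S_def poly_roots_finite)
    fix p assume p: "p \<notin> S"
    have "coeff (?slice p B) j \<noteq> 0"
      using p by (simp add: coeff_map_poly S_def)
    then have "?slice p B \<noteq> 0"
      by auto
    moreover have "?slice p pinchuk_sextic * ?slice p A^2 * ?slice p B^4 =
        [:0, 1:]^2 * (\<Sum>i\<le>6. smult (coeff (?slice p pinchuk_sextic) i) (?slice p A^i * ?slice p B^(6 - i)))"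
      (is "?l = ?r")
    proof (rule poly_eq_poly_eq_iff[THEN iffD1], rule ext)
      fix b
      have "eval2 (pinchuk_sextic * A^2 * B^4) (p, b)
        = eval2 (var_y^2 * (\<Sum>i\<le>6. [:coeff pinchuk_sextic i:] * A^i * B^(6 - i))) (p, b)"
        by (simp only: eq)
      then show "poly ?l b = poly ?r b"
        by (simp add: poly_slice poly_sum eval2_sum coeff_map_poly mult.assoc)
    qed
    ultimately have "?slice p A = [:0, 1:] * ?slice p B"
      using p by (intro Laurent_root_unique[of "?slice p pinchuk_sextic"])
        (auto simp: S_def sextic_slice_coeffs sextic_slice_coeffs(2)[unfolded One_nat_def] add_eq_0_iff)
    then have "poly (?slice p A) b = poly ([:0, 1:] * ?slice p B) b" for b
      by (rule arg_cong)
    then have "eval2 (A - var_y * B) (p, b) = 0" for b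
      by (simp add: poly_slice)
    then show "finite {b. eval2 (A - var_y * B) (p, b) \<noteq> 0}"
      by simp
  qed
  then show ?thesis
    by simp
qed

text \<open>Any \<open>z\<close> is some \<open>A(P, f) / B(P, f)\<close>. Clearing denominators and
  using the independence of \<open>P\<close> and \<open>f\<close> leads to the polynomial identity
  of \<open>sextic_root_unique\<close>.\<close>

lemma pinchuk_f_conjugate_unique:
  assumes "to_fract pinchuk_Q * z^2 = (\<Sum>i\<le>6. to_fract (subst1 (coeff pinchuk_sextic i) pinchuk_P) * z^i)"
  shows "z = to_fract pinchuk_f"
proof -
  let ?s = "\<lambda>w. subst2 w pinchuk_P pinchuk_f"
  have "z \<in> composites pinchuk_P pinchuk_f"
    by (simp add: composites_P_f)
  then obtain A B where z: "z = to_fract (?s A) / to_fract (?s B)" and B: "?s B \<noteq> 0"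
    unfolding composites_def by blast
  have nz: "to_fract (?s B) \<noteq> 0"
    using B by simp
  have "to_fract (pinchuk_Q * ?s A^2 * ?s B^4) = to_fract pinchuk_Q * z^2 * to_fract (?s B)^6"
    using nz by (simp add: z to_fract_power power_divide eval_nat_numeral)
  also have "\<dots> = (\<Sum>i\<le>6. to_fract (subst1 (coeff pinchuk_sextic i) pinchuk_P) * (z^i * to_fract (?s B)^6))"
    unfolding assms by (simp add: sum_distrib_right mult.assoc)
  also have "\<dots> = (\<Sum>i\<le>6. to_fract (subst1 (coeff pinchuk_sextic i) pinchuk_P * (?s A^i * ?s B^(6 - i))))"
  proof (intro sum.cong refl)
    fix i :: nat assume "i \<in> {..6}"
    then have "to_fract (?s B)^6 = to_fract (?s B)^i * to_fract (?s B)^(6 - i)"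
      by (simp flip: power_add)
    then have "z^i * to_fract (?s B)^6 = to_fract (?s A)^i * to_fract (?s B)^(6 - i)"
      using nz by (simp add: z power_divide)
    then show "to_fract (subst1 (coeff pinchuk_sextic i) pinchuk_P) * (z^i * to_fract (?s B)^6) =
        to_fract (subst1 (coeff pinchuk_sextic i) pinchuk_P * (?s A^i * ?s B^(6 - i)))"
      by (simp add: to_fract_power)
  qed
  finally have "pinchuk_Q * ?s A^2 * ?s B^4
      = (\<Sum>i\<le>6. subst1 (coeff pinchuk_sextic i) pinchuk_P * (?s A^i * ?s B^(6 - i)))"
    by (simp only: to_fract_sum[symmetric] to_fract_eq_iff)
  \<comment> \<open>The extra factor \<open>f^2\<close> lets the sextic replace
    \<open>Q * f^2\<close>, leaving only \<open>P\<close> and \<open>f\<close>.\<close>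
  then have "pinchuk_Q * pinchuk_f^2 * (?s A^2 * ?s B^4)
      = pinchuk_f^2 * (\<Sum>i\<le>6. subst1 (coeff pinchuk_sextic i) pinchuk_P * (?s A^i * ?s B^(6 - i)))"
    by (simp add: mult_ac)
  then have "?s (pinchuk_sextic * A^2 * B^4 - var_y^2 * (\<Sum>i\<le>6. [:coeff pinchuk_sextic i:] * A^i * B^(6 - i))) = 0"
    by (simp add: pinchuk_sextic_relation subst2_simps subst2_sum subst2_smult mult.assoc)
  from subst2_P_f_eq_0[OF this]
  have "pinchuk_sextic * A^2 * B^4 = var_y^2 * (\<Sum>i\<le>6. [:coeff pinchuk_sextic i:] * A^i * B^(6 - i))"
    by simp
  moreover have "B \<noteq> 0"
    using B by auto
  ultimately have "A = var_y * B"
    by (intro sextic_root_unique)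
  with nz show ?thesis
    by (simp add: z subst2_simps)
qed


section \<open>Degree of a simple extension\<close>

text \<open>The minimal polynomial divides \<open>p\<close>, so its degree is at most
  \<open>n\<close>; a smaller degree would contradict the independence of the first \<open>n\<close>
  powers.\<close>

lemma (in field) simple_extension_of_degree:
  assumes K: "subfield K R" and x: "x \<in> carrier R"
    and p: "set p \<subseteq> K" "length p = Suc n" "hd p \<noteq> \<zero>" "eval p x = \<zero>"
    and independent: "\<And>q. set q \<subseteq> K \<Longrightarrow> length q = n \<Longrightarrow> eval q x = \<zero> \<Longrightarrow> set q \<subseteq> {\<zero>}"
  shows "dimension n K (simple_extension K x)" and "subfield (simple_extension K x) R"
proof -
  have p_carrier: "p \<in> carrier (K[X])" and "p \<noteq> []"
    using p unfolding univ_poly_carrier[symmetric] polynomial_def by auto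
  have alg: "(algebraic over K) x"
    by (rule algebraicI[OF p_carrier \<open>p \<noteq> []\<close> p(4)])
  then show "subfield (simple_extension K x) R"
    using simple_extension_is_subfield[OF K x] by blast
  let ?I = "Irr K x"
  note I = IrrE[OF K x alg]
  have I_set: "set ?I \<subseteq> K"
    using I(1) unfolding univ_poly_carrier[symmetric] polynomial_def by auto
  have "?I \<noteq> []"
    using I(2) unfolding ring_irreducible_def univ_poly_zero by auto
  have "length ?I - 1 \<le> length p - 1"
    using pdivides_imp_degree_le[OF subfieldE(1)[OF K] I(1) p_carrier \<open>p \<noteq> []\<close>
        Irr_minimal[OF K x alg p_carrier p(4)]] by simp
  moreover have "\<not> length ?I \<le> n"
  proof
    assume le: "length ?I \<le> n"
    \<comment> \<open>Polynomials are lists with the leading coefficient first, so zeros in front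
      pad to length \<open>n\<close> without changing the value.\<close>
    define q where "q = replicate (n - length ?I) \<zero> @ ?I"
    have carrier: "set ?I \<subseteq> carrier R"
      using I_set subfieldE(3)[OF K] by blast
    have "eval q x = eval ?I x"
      unfolding q_def by (rule eval_replicate[OF carrier x])
    moreover have "set q \<subseteq> K" "length q = n"
      using I_set subringE(2)[OF subfieldE(1)[OF K]] le by (auto simp: q_def)
    ultimately have "set q \<subseteq> {\<zero>}"
      using independent I(4) by simp
    moreover have "\<one> \<in> set q"
      using I(3) \<open>?I \<noteq> []\<close> hd_in_set[of ?I] by (simp add: q_def)
    ultimately show False
      by auto
  qed
  ultimately have "length ?I - 1 = n"
    using p(2) by linarith
  then show "dimension n K (simple_extension K x)"
    using dimension_simple_extension[OF K x alg] by simp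
qed

lemma eval_type_algebra:
  fixes x :: "'a :: field"
  shows "ring.eval ring_of_type_algebra p x = (\<Sum>i<length p. rev p ! i * x ^ i)"
proof -
  interpret R: field "ring_of_type_algebra :: 'a ring" ..
  show ?thesis
  proof (induction p)
    case (Cons a p)
    have "(\<Sum>i<length p. (rev p @ [a]) ! i * x ^ i) = (\<Sum>i<length p. rev p ! i * x ^ i)"
      by (intro sum.cong refl) (simp add: nth_append)
    with Cons show ?case
      by (simp add: nth_append add.commute)
  qed simp
qed

text \<open>At \<open>x = 0\<close> the polynomial \<open>P\<close> is \<open>y\<close>, so \<open>v\<close> can be read off from \<open>Q\<close> there.\<close>

lemma pinchuk_shift_coeffs:
  assumes k: "subfield k (ring_of_type_algebra :: real ring)"
    and "\<And>j. coeff (coeff (pinchuk_Q - subst1 v pinchuk_P) j) 0 \<in> k"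
  shows "coeff v j \<in> k"
proof -
  define S where "S = map_poly (\<lambda>c. poly c 0) (pinchuk_Q - subst1 v pinchuk_P)"
  \<comment> \<open>At \<open>x = 0\<close> one has \<open>t = h = -1\<close> and
    \<open>f = y + 1\<close>, so \<open>pinchuk_Q\<close> restricts to
    \<open>50 * y + 33/4\<close>.\<close>
  have "poly S b = poly ([:33/4, 50:] - v) b" for b
    by (simp add: S_def poly_slice pinchuk_Q_def pinchuk_q_def pinchuk_P_def pinchuk_t_def
        pinchuk_h_def pinchuk_f_def pinchuk_u_def)
  then have "S = [:33/4, 50:] - v"
    by (intro poly_eq_poly_eq_iff[THEN iffD1] ext)
  then have "coeff v j = coeff [:33/4, 50:] j - coeff S j"
    by simp
  moreover have "coeff S j \<in> k"
    using assms(2)[of j] by (simp add: S_def coeff_map_poly poly_0_coeff_0)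
  moreover have "coeff [:33/4, 50:] j \<in> k"
    by (auto simp: coeff_pCons split: nat.split intro!: subfield_type_algebraD[OF k])
  ultimately show ?thesis
    by (simp add: subfield_type_algebraD(7)[OF k])
qed

lemma sextic_coeffs_in_subfield:
  assumes k: "subfield k (ring_of_type_algebra :: real ring)"
  shows "coeff (coeff pinchuk_sextic i) j \<in> k"
  by (auto simp: pinchuk_sextic_def coeff_pCons split: nat.split intro!: subfield_type_algebraD[OF k])

text \<open>Multiplying by the product of all denominators reduces to polynomial
  coefficients.\<close>

lemma pinchuk_powers_independent_composites:
  assumes a: "\<And>i. i < 6 \<Longrightarrow> a i \<in> composites pinchuk_P pinchuk_Q"
    and zero: "(\<Sum>i<6. a i * to_fract pinchuk_f ^ i) = 0" and "i < (6::nat)"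
  shows "a i = 0"
proof -
  let ?s = "\<lambda>w. subst2 w pinchuk_P pinchuk_Q"
  have "\<forall>i. \<exists>c d. i < 6 \<longrightarrow> a i = to_fract (?s c) / to_fract (?s d) \<and> ?s d \<noteq> 0"
    using a unfolding composites_def by blast
  then obtain c d where cd: "\<And>i. i < 6 \<Longrightarrow> a i = to_fract (?s (c i)) / to_fract (?s (d i))"
      "\<And>i. i < 6 \<Longrightarrow> ?s (d i) \<noteq> 0"
    by metis
  define D where "D = (\<Prod>j<6. d j)"
  define e where "e i = c i * (\<Prod>j\<in>{..<6} - {i}. d j)" for i
  have D: "?s D \<noteq> 0"
    using cd(2) by (simp add: D_def subst2_prod)
  have e: "a i * to_fract (?s D) = to_fract (?s (e i))" if "i < 6" for i
  proof -
    have "D = d i * (\<Prod>j\<in>{..<6} - {i}. d j)"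
      unfolding D_def using that by (intro prod.remove) auto
    then show ?thesis
      using cd[OF that] by (simp add: e_def subst2_simps)
  qed
  have "to_fract (\<Sum>i<6. ?s (e i) * pinchuk_f ^ i) = (\<Sum>i<6. to_fract (?s (e i)) * to_fract pinchuk_f ^ i)"
    by (simp add: to_fract_power)
  also have "\<dots> = (\<Sum>i<6. a i * to_fract (?s D) * to_fract pinchuk_f ^ i)"
    by (intro sum.cong refl) (simp add: e)
  also have "\<dots> = to_fract (?s D) * (\<Sum>i<6. a i * to_fract pinchuk_f ^ i)"
    by (simp add: sum_distrib_left mult_ac)
  finally have "to_fract (\<Sum>i<6. ?s (e i) * pinchuk_f ^ i) = 0"
    by (simp only: zero mult_zero_right)
  then have "(\<Sum>i<6. ?s (e i) * pinchuk_f ^ i) = 0"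
    by (simp only: to_fract_eq_0_iff)
  then have "e i = 0"
    using \<open>i < 6\<close> by (rule pinchuk_powers_independent)
  then show ?thesis
    using e[OF \<open>i < 6\<close>] D by simp
qed

lemma relative_automorphisms_trivial:
  assumes K: "K \<subseteq> E" and E: "subfield E R"
    and fix_all: "\<And>\<sigma> z. \<sigma> \<in> relative_automorphisms R K E \<Longrightarrow> z \<in> E \<Longrightarrow> \<sigma> z = z"
  shows "relative_automorphisms R K E = {\<lambda>z\<in>E. z}"
proof (rule equalityI)
  show "relative_automorphisms R K E \<subseteq> {\<lambda>z\<in>E. z}"
  proof
    fix \<sigma> assume \<sigma>: "\<sigma> \<in> relative_automorphisms R K E"
    then have "\<sigma> \<in> extensional E"
      by (simp add: relative_automorphisms_def)
    with fix_all[OF \<sigma>] show "\<sigma> \<in> {\<lambda>z\<in>E. z}"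
      by (auto simp: extensional_def fun_eq_iff restrict_def)
  qed
  note closed = subringE[OF subfieldE(1)[OF E]]
  have "(\<lambda>z\<in>E. z) \<in> ring_iso (R\<lparr>carrier := E\<rparr>) (R\<lparr>carrier := E\<rparr>)"
    using closed by (intro ring_iso_memI) (auto simp: bij_betw_def inj_on_def)
  then show "{\<lambda>z\<in>E. z} \<subseteq> relative_automorphisms R K E"
    using K by (auto simp: relative_automorphisms_def)
qed


lemma sextic_relation_sum:
  "to_fract pinchuk_Q * to_fract pinchuk_f ^ 2 =
     (\<Sum>i\<le>6. to_fract (subst1 (coeff pinchuk_sextic i) pinchuk_P) * to_fract pinchuk_f ^ i)"
proof -
  have "subst2 pinchuk_sextic pinchuk_P pinchuk_f =
      (\<Sum>i\<le>6. subst1 (coeff pinchuk_sextic i) pinchuk_P * pinchuk_f ^ i)"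
    by (rule eval2_eqI) (simp add: eval2_sum pinchuk_sextic_def eval_nat_numeral algebra_simps)
  then have "to_fract (pinchuk_Q * pinchuk_f ^ 2) =
      to_fract (\<Sum>i\<le>6. subst1 (coeff pinchuk_sextic i) pinchuk_P * pinchuk_f ^ i)"
    by (simp only: pinchuk_sextic_relation)
  then show ?thesis
    by (simp add: to_fract_power)
qed

text \<open>Lets an automorphism be tested on generators only.\<close>

lemma subfield_fixed_points:
  fixes \<sigma> :: "'a :: field \<Rightarrow> 'a"
  assumes E: "subfield E ring_of_type_algebra"
    and \<sigma>: "\<sigma> \<in> ring_iso (ring_of_type_algebra\<lparr>carrier := E\<rparr>) (ring_of_type_algebra\<lparr>carrier := E\<rparr>)"
  shows "subfield {z \<in> E. \<sigma> z = z} ring_of_type_algebra"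
proof (rule subfield_type_algebraI)
  note closed = subfield_type_algebraD[OF E]
  have mult: "\<sigma> (x * y) = \<sigma> x * \<sigma> y" and add: "\<sigma> (x + y) = \<sigma> x + \<sigma> y"
    if "x \<in> E" "y \<in> E" for x y
    using that ring_iso_memE(2,3)[OF \<sigma>, of x y] by simp_all
  have one: "\<sigma> 1 = 1"
    using ring_iso_memE(4)[OF \<sigma>] by simp
  have "\<sigma> 0 + \<sigma> 0 = \<sigma> 0 + 0"
    using add[of 0 0] closed(1) by simp
  then have zero: "\<sigma> 0 = 0"
    by (rule add_left_imp_eq)
  show "1 \<in> {z \<in> E. \<sigma> z = z}"
    using one closed by simp
  fix x assume x: "x \<in> {z \<in> E. \<sigma> z = z}"
  have "\<sigma> (- x) + x = 0"
    using add[of "- x" x] x zero closed(4)[of x] by simp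
  then show "- x \<in> {z \<in> E. \<sigma> z = z}"
    using x closed(4)[of x] by (simp add: eq_neg_iff_add_eq_0)
  show "inverse x \<in> {z \<in> E. \<sigma> z = z}" if "x \<noteq> 0"
  proof -
    have "\<sigma> (inverse x) * x = 1"
      using mult[of "inverse x" x] x one that closed(6)[of x] by simp
    then have "\<sigma> (inverse x) = inverse x"
      using that by (simp add: field_simps)
    then show ?thesis
      using x closed(6)[of x] by simp
  qed
  fix y assume "y \<in> {z \<in> E. \<sigma> z = z}"
  then show "x + y \<in> {z \<in> E. \<sigma> z = z}" "x * y \<in> {z \<in> E. \<sigma> z = z}"
    using x mult add closed by auto
qed

theorem theorem2p1:
  fixes P Q :: "real poly poly" and k :: "real set"
  assumes "is_pinchuk_map P Q"
    and "subfield k (ring_of_type_algebra :: real ring)"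
    and "\<And>i j. Polynomial.coeff (Polynomial.coeff P j) i \<in> k"
    and "\<And>i j. Polynomial.coeff (Polynomial.coeff Q j) i \<in> k"
  shows "generically_two_to_one (polynomial_map P Q)
    \<and> ring.dimension real_rat_functions 6 (adjoin k {P, Q}) (adjoin k {var_x, var_y})
    \<and> relative_automorphisms real_rat_functions (adjoin k {P, Q}) (adjoin k {var_x, var_y})
        = {\<lambda>z\<in>adjoin k {var_x, var_y}. z}
    \<and> \<not> galois_extension real_rat_functions (adjoin k {P, Q}) (adjoin k {var_x, var_y})"
proof -
  interpret R: field real_rat_functions ..
  obtain v where P: "P = pinchuk_P" and Q: "Q = pinchuk_Q - subst1 v pinchuk_P"
    using pinchuk_map_normal_form[OF assms(1)] .
  define K where "K = adjoin k {P, Q}"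
  define E where "E = adjoin k {var_x, var_y}"
  define F where "F = to_fract pinchuk_f"
  have K: "subfield K real_rat_functions" and E: "subfield E real_rat_functions"
    by (simp_all add: K_def E_def adjoin_subfield)
  note K_closed = subfield_type_algebraD[OF K] and E_closed = subfield_type_algebraD[OF E]
  have K_const: "to_fract (const2 c) \<in> K" and E_const: "to_fract (const2 c) \<in> E" if "c \<in> k" for c
    using that by (simp_all add: K_def E_def adjoin_const)
  have P_K: "to_fract pinchuk_P \<in> K" and "to_fract Q \<in> K"
    by (simp_all add: K_def P[symmetric] adjoin_gen)
  have "coeff v j \<in> k" for j
    by (rule pinchuk_shift_coeffs[OF assms(2)]) (rule assms(4)[unfolded Q])
  then have "to_fract (subst1 v pinchuk_P) \<in> K"
    by (intro subst1_in_subfield[OF K K_const P_K])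
  with \<open>to_fract Q \<in> K\<close> have Q_K: "to_fract pinchuk_Q \<in> K"
    using K_closed(3)[of "to_fract Q" "to_fract (subst1 v pinchuk_P)"] by (simp add: Q)
  \<comment> \<open>Independence of the powers of \<open>f\<close> over this larger field gives
    independence over \<open>K\<close>.\<close>
  have K_composites: "K \<subseteq> composites pinchuk_P pinchuk_Q"
    unfolding K_def
  proof (rule adjoin_minimal[OF subfield_composites])
    have "to_fract (subst1 v pinchuk_P) \<in> composites pinchuk_P pinchuk_Q"
      by (rule subst1_in_subfield[OF subfield_composites, of UNIV])
        (simp_all add: composites_generators)
    then have "to_fract Q \<in> composites pinchuk_P pinchuk_Q"
      by (simp add: Q subfield_type_algebraD[OF subfield_composites] composites_generators)
    then show "to_fract s \<in> composites pinchuk_P pinchuk_Q" if "s \<in> {P, Q}" for s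
      using that by (auto simp: P composites_generators)
  qed (rule composites_generators)
  have xy_E: "to_fract var_x \<in> E" "to_fract var_y \<in> E"
    by (simp_all add: E_def adjoin_gen)
  have K_E: "K \<subseteq> E"
    unfolding K_def
  proof (rule adjoin_minimal[OF E])
    show "to_fract s \<in> E" if "s \<in> {P, Q}" for s
      using that assms(3,4) by (intro polynomial_in_subfield[OF E E_const xy_E]) auto
  qed (rule E_const)
  have F_E: "F \<in> E"
    using xy_E by (simp add: F_def pinchuk_f_def pinchuk_t_def to_fract_power E_closed)

  define c where "c i = to_fract (subst1 (coeff pinchuk_sextic i) pinchuk_P)" for i
  have c_K: "c i \<in> K" for i
    unfolding c_def
    by (rule subst1_in_subfield[OF K K_const P_K sextic_coeffs_in_subfield[OF assms(2)]])
  have relation: "to_fract pinchuk_Q * F ^ 2 = (\<Sum>i\<le>6. c i * F ^ i)"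
    unfolding F_def c_def by (rule sextic_relation_sum)
  \<comment> \<open>The sextic relation moved to one side, which puts \<open>Q\<close> into the
    coefficient of \<open>F^2\<close>.\<close>
  define p where "p = [c 6, c 5, c 4, c 3, c 2 - to_fract pinchuk_Q, c 1, c 0]"
  have "c 6 \<noteq> 0"
    by (simp add: c_def pinchuk_sextic_def numeral_eq_Suc subst1_pCons const2_def)
  then have p: "set p \<subseteq> K" "length p = Suc 6" "hd p \<noteq> \<zero>\<^bsub>real_rat_functions\<^esub>"
    using c_K Q_K by (auto simp: p_def K_closed)
  have eval_p: "R.eval p F = \<zero>\<^bsub>real_rat_functions\<^esub>"
    using relation
    by (simp add: eval_type_algebra p_def eval_nat_numeral algebra_simps)
  have independent: "set q \<subseteq> {\<zero>\<^bsub>real_rat_functions\<^esub>}"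
    if q: "set q \<subseteq> K" "length q = 6" "R.eval q F = \<zero>\<^bsub>real_rat_functions\<^esub>" for q
  proof -
    have "rev q ! i = 0" if "i < 6" for i
    proof (rule pinchuk_powers_independent_composites[where a = "\<lambda>i. rev q ! i"])
      show "rev q ! j \<in> composites pinchuk_P pinchuk_Q" if "j < 6" for j
        using that q(1,2) K_composites nth_mem[of j "rev q"] by auto
      show "(\<Sum>i<6. rev q ! i * to_fract pinchuk_f ^ i) = 0"
        using q(2,3) by (simp add: eval_type_algebra F_def)
    qed (rule that)
    then have "set (rev q) \<subseteq> {0}"
      using q(2) by (metis in_set_conv_nth length_rev singletonI subsetI)
    then show ?thesis
      by simp
  qed
  have "F \<in> carrier real_rat_functions"
    by simp
  note ext = R.simple_extension_of_degree[OF K this p eval_p independent]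
  have "R.simple_extension K F = E"
  proof (rule equalityI)
    show "R.simple_extension K F \<subseteq> E"
      using R.simple_extension_subring_incl[OF subfieldE(1)[OF E] K_E F_E] .
    have K_ext: "K \<subseteq> R.simple_extension K F"
      by (rule R.simple_extension_incl) simp_all
    have "to_fract pinchuk_f \<in> R.simple_extension K F"
      unfolding F_def by (rule R.simple_extension_mem[OF subfieldE(1)[OF K]]) simp
    moreover have "to_fract pinchuk_P \<in> R.simple_extension K F"
      using P_K K_ext by blast
    ultimately have "to_fract var_x \<in> R.simple_extension K F" "to_fract var_y \<in> R.simple_extension K F"
      by (simp_all only: subfield_contains_x_y[OF ext(2)])
    then show "E \<subseteq> R.simple_extension K F"
      unfolding E_def using K_const K_ext by (intro adjoin_minimal ext(2)) auto
  qed
  with ext(1) have dimension: "R.dimension 6 K E"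
    by simp

  have "\<sigma> z = z" if \<sigma>: "\<sigma> \<in> relative_automorphisms real_rat_functions K E" and "z \<in> E" for \<sigma> z
  proof -
    from \<sigma> have iso: "\<sigma> \<in> ring_iso (real_rat_functions\<lparr>carrier := E\<rparr>) (real_rat_functions\<lparr>carrier := E\<rparr>)"
      and fixed: "\<And>z. z \<in> K \<Longrightarrow> \<sigma> z = z"
      by (auto simp: relative_automorphisms_def)
    have mult: "\<sigma> (x * y) = \<sigma> x * \<sigma> y" and add: "\<sigma> (x + y) = \<sigma> x + \<sigma> y"
      if "x \<in> E" "y \<in> E" for x y
      using that ring_iso_memE(2,3)[OF iso, of x y] by simp_all
    have power: "\<sigma> (F ^ n) = \<sigma> F ^ n" for n
      by (induction n) (auto simp: mult F_E E_closed fixed[OF K_closed(2)])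
    have term_E: "c i * F ^ i \<in> E" for i
      using c_K K_E F_E by (blast intro: E_closed)
    \<comment> \<open>Membership in \<open>E\<close> is carried along because
      \<open>\<sigma>\<close> is additive on \<open>E\<close> only.\<close>
    have "\<sigma> (\<Sum>i\<le>n. c i * F ^ i) = (\<Sum>i\<le>n. c i * \<sigma> F ^ i) \<and> (\<Sum>i\<le>n. c i * F ^ i) \<in> E" for n
    proof (induction n)
      case 0
      show ?case
        using c_K K_E by (auto simp: fixed)
    next
      case (Suc n)
      have "\<sigma> (c (Suc n) * F ^ Suc n) = c (Suc n) * \<sigma> F ^ Suc n"
        using c_K K_E F_E mult[of "c (Suc n)" "F ^ Suc n"] by (auto simp only: E_closed power fixed)
      with Suc show ?case
        using term_E[of "Suc n"] by (simp only: sum.atMost_Suc add E_closed simp_thms)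
    qed
    then have "\<sigma> (to_fract pinchuk_Q * F ^ 2) = (\<Sum>i\<le>6. c i * \<sigma> F ^ i)"
      by (simp add: relation)
    moreover have "\<sigma> (to_fract pinchuk_Q * F ^ 2) = to_fract pinchuk_Q * \<sigma> F ^ 2"
      using Q_K K_E F_E mult[of "to_fract pinchuk_Q" "F ^ 2"] by (auto simp only: E_closed power fixed)
    \<comment> \<open>The coefficients lie in \<open>K\<close>, so \<open>\<sigma> F\<close>
      satisfies the same equation as \<open>F\<close>.\<close>
    ultimately have "\<sigma> F = F"
      unfolding c_def F_def by (intro pinchuk_f_conjugate_unique) simp
    let ?L = "{z \<in> E. \<sigma> z = z}"
    have L: "subfield ?L real_rat_functions"
      by (rule subfield_fixed_points[OF E iso])
    have K_L: "K \<subseteq> ?L"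
      using K_E fixed by auto
    have "to_fract pinchuk_f \<in> ?L"
      using F_E \<open>\<sigma> F = F\<close> by (simp add: F_def)
    moreover have "to_fract pinchuk_P \<in> ?L"
      using P_K K_L by blast
    ultimately have "to_fract var_x \<in> ?L" "to_fract var_y \<in> ?L"
      by (simp_all only: subfield_contains_x_y[OF L])
    then have "E \<subseteq> ?L"
      using K_const K_L unfolding E_def by (intro adjoin_minimal L[unfolded E_def]) auto
    with \<open>z \<in> E\<close> show ?thesis
      by blast
  qed
  then have automorphisms: "relative_automorphisms real_rat_functions K E = {\<lambda>z\<in>E. z}"
    by (rule relative_automorphisms_trivial[OF K_E E])

  \<comment> \<open>Otherwise \<open>F * 1 - 1 * F = 0\<close> would be a nontrivial relation
    between powers of \<open>F\<close> over \<open>K\<close>. Hence the fixed field \<open>E\<close>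
    of the trivial group is larger than \<open>K\<close>.\<close>
  have "F \<notin> K"
  proof
    assume "F \<in> K"
    define a where "a i = (if i = 0 then F else if i = 1 then - 1 else 0)" for i :: nat
    have "a 1 = 0"
    proof (rule pinchuk_powers_independent_composites)
      show "a i \<in> composites pinchuk_P pinchuk_Q" for i
        using \<open>F \<in> K\<close> K_composites
        by (auto simp: a_def subfield_type_algebraD[OF subfield_composites])
      show "(\<Sum>i<6. a i * to_fract pinchuk_f ^ i) = 0"
        by (simp add: a_def eval_nat_numeral F_def)
    qed simp
    then show False
      by (simp add: a_def)
  qed
  moreover have "{z \<in> E. \<forall>\<sigma>\<in>relative_automorphisms real_rat_functions K E. \<sigma> z = z} = E"
    by (auto simp: automorphisms)
  ultimately have "\<not> galois_extension real_rat_functions K E"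
    using F_E by (auto simp: galois_extension_def)
  then show ?thesis
    using generically_two_to_one_pinchuk[of v] dimension automorphisms
    by (simp add: P Q K_def E_def)
qed

end
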